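(* Let $k\ge0$ be a fixed integer. As $n\to\infty$, the average height of the partial Łukasiewicz paths of length $n$ ending at height $k$ (each such path being equally likely) is asymptotically equivalent to $\sqrt{\pi n}$.
   Context: A partial Łukasiewicz path of length $n\ge 0$ is a lattice path starting at $(0,0)$, consisting of $n$ steps from $\{(1,j): j\ge -1\}$, and never going below the $x$-axis. Its height is the maximal $y$-coordinate of its points; it ends at height $k$ if its end point has $y$-coordinate $k$. For fixed $n\ge1$ and $k$ there are finitely many such paths. Two sequences are asymptotically equivalent if their ratio tends to $1$. *)

theory Defs
  imports "HOL-Analysis.Analysis" "HOL-Library.Landau_Symbols"
begin

(* A path starting at (0,0) is encoded by the list of the ordinates j of its steps (1,j);
   its points are then (i, ordinate p i) for i = 0, ..., length p. *)

definition ordinate :: "int list \<Rightarrow> nat \<Rightarrow> int" where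
  "ordinate p i = sum_list (take i p)"

definition partial_lukasiewicz :: "int list \<Rightarrow> bool" where
  "partial_lukasiewicz p \<longleftrightarrow>
     (\<forall>j\<in>set p. j \<ge> -1) \<and> (\<forall>i\<le>length p. ordinate p i \<ge> 0)"

definition path_height :: "int list \<Rightarrow> int" where
  "path_height p = Max (ordinate p ` {0..length p})"

definition lukasiewicz_paths :: "nat \<Rightarrow> nat \<Rightarrow> int list set" where
  "lukasiewicz_paths n k =
     {p. partial_lukasiewicz p \<and> length p = n \<and> ordinate p n = int k}"

definition average_height :: "nat \<Rightarrow> nat \<Rightarrow> real" where
  "average_height n k =
     (\<Sum>p\<in>lukasiewicz_paths n k. real_of_int (path_height p)) / real (card (lukasiewicz_paths n k))"

(* The next two facts ensure that the average above is not a degenerate sum or quotient. *)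

lemma step_le_sum_list:
  fixes p :: "int list"
  assumes "\<forall>j\<in>set p. j \<ge> -1"
  shows "- int (length p) \<le> sum_list p \<and> (\<forall>j\<in>set p. j \<le> sum_list p + int (length p))"
  using assms by (induction p) fastforce+

lemma finite_lukasiewicz_paths: "finite (lukasiewicz_paths n k)"
proof (rule finite_subset)
  show "lukasiewicz_paths n k \<subseteq> {p. set p \<subseteq> {-1..int k + int n} \<and> length p = n}"
    using step_le_sum_list
    by (fastforce simp: lukasiewicz_paths_def partial_lukasiewicz_def ordinate_def)
  show "finite {p. set p \<subseteq> {-1..int k + int n} \<and> length p = n}"
    by (rule finite_lists_length_eq) simp
qed

lemma lukasiewicz_paths_nonempty:
  assumes "n \<ge> 1"
  shows "lukasiewicz_paths n k \<noteq> {}"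
proof -
  have "int k # replicate (n - 1) 0 \<in> lukasiewicz_paths n k"
    using assms
    by (auto simp: lukasiewicz_paths_def partial_lukasiewicz_def ordinate_def take_Cons'
        sum_list_replicate)
  then show ?thesis by blast
qed

end

theory Submission
  imports Defs "HOL-Probability.Distributions" "HOL-Real_Asymp.Real_Asymp"
begin

text \<open>
  Paths that stay at height at most \<open>h\<close> are counted by the reflection principle. Appending a step
  shows that their numbers satisfy the recurrence of a walk with steps up and down that is absorbed
  at the ordinates \<open>-2\<close> and \<open>h + 1\<close>; hence they are alternating sums of binomial coefficients
  along an arithmetic progression of difference \<open>H = h + 3\<close> (\<open>card_low_paths\<close>).
  After division by the number of all paths, the terms of index \<open>j\<close> and \<open>-j\<close> combine into
  second differences of binomial coefficients, so that the proportion of paths of height greater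
  than \<open>h\<close> is \<open>\<Sum>j=1..n. tail_term k n (j * H)\<close> (\<open>proportion_of_high_paths\<close>).

  The function \<open>tail_term k n y\<close> converges to \<open>(4 u\<^sup>2 - 2) exp (- u\<^sup>2)\<close> when \<open>y / sqrt n\<close> tends
  to \<open>u\<close>, and it is \<open>O(n / y\<^sup>2)\<close> uniformly (\<open>tail_term_tendsto\<close>, \<open>tail_term_bound\<close>).
  The average height is the sum over \<open>h\<close> of these proportions. The limiting density of each \<open>j\<close> has
  integral zero over the whole half-line, so the double sum must not be rearranged near \<open>h = 0\<close>.
  Instead, fix \<open>\<epsilon> > 0\<close>. The levels with \<open>H \<le> \<epsilon> sqrt n\<close> contribute between \<open>0\<close> and about
  \<open>\<epsilon> sqrt n\<close>, because each proportion lies in \<open>[0, 1]\<close>. For the remaining levels the two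
  sums may be exchanged, and dominated convergence (over \<open>H\<close>) followed by Tannery's theorem (over \<open>j\<close>)
  gives, on the scale \<open>sqrt n\<close>, the limit \<open>\<Sum>j. 2 \<epsilon> exp (- (j \<epsilon>)\<^sup>2)\<close>, since
  \<open>(4 j\<^sup>2 t\<^sup>2 - 2) exp (- (j t)\<^sup>2)\<close> is the derivative of \<open>- 2 t exp (- (j t)\<^sup>2)\<close>.
  This is twice a Riemann sum of the Gaussian integral \<open>sqrt pi / 2\<close> with mesh \<open>\<epsilon>\<close>
  (\<open>gaussian_riemann_sum\<close>), and \<open>\<epsilon>\<close> is arbitrary.
\<close>

section \<open>Paths in a strip\<close>

definition low_paths :: "nat \<Rightarrow> nat \<Rightarrow> nat \<Rightarrow> int list set" where
  "low_paths h n k = {p \<in> lukasiewicz_paths n k. path_height p \<le> int h}"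

lemma path_height_le_iff: "path_height p \<le> b \<longleftrightarrow> (\<forall>i\<le>length p. ordinate p i \<le> b)"
  unfolding path_height_def by (subst Max_le_iff) auto

lemma low_paths_iff:
  "p \<in> low_paths h n k \<longleftrightarrow>
     (\<forall>j\<in>set p. j \<ge> -1) \<and> length p = n \<and> sum_list p = int k \<and>
     (\<forall>i\<le>n. 0 \<le> ordinate p i \<and> ordinate p i \<le> int h)"
  unfolding low_paths_def lukasiewicz_paths_def partial_lukasiewicz_def path_height_le_iff
  by (auto simp: ordinate_def)

lemma finite_low_paths: "finite (low_paths h n k)"
  unfolding low_paths_def using finite_lukasiewicz_paths by simp

text \<open>
  The only step that leads from ordinate \<open>i\<close> to \<open>k\<close> is \<open>k - i\<close>, and it is admissible
  exactly when \<open>i \<le> k + 1\<close>; this gives the recurrence in the length.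
\<close>

lemma snoc_in_low_paths_iff:
  "p @ [j] \<in> low_paths h (Suc n) k \<longleftrightarrow>
     k \<le> h \<and> (\<exists>i. p \<in> low_paths h n i \<and> i \<le> k + 1 \<and> j = int k - int i)"
  (is "?L \<longleftrightarrow> ?R")
proof
  assume L: ?L
  have len: "length p = n" using L by (simp add: low_paths_iff)
  have ord: "ordinate (p @ [j]) i = ordinate p i" if "i \<le> n" for i
    using that len by (simp add: ordinate_def)
  have ordp: "0 \<le> ordinate p i \<and> ordinate p i \<le> int h" if "i \<le> n" for i
    using L ord[OF that] that unfolding low_paths_iff by (metis le_SucI)
  have "ordinate p n = sum_list p" using len by (simp add: ordinate_def)
  with ordp[of n] have "sum_list p \<ge> 0" by simp
  then obtain i where i: "sum_list p = int i" using nonneg_int_cases by blast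
  have j: "j \<ge> -1" "int i + j = int k" using L i by (auto simp: low_paths_iff)
  have "ordinate (p @ [j]) (Suc n) = int k" using L len by (simp add: low_paths_iff ordinate_def)
  moreover have "ordinate (p @ [j]) (Suc n) \<le> int h" using L by (auto simp: low_paths_iff)
  ultimately have "k \<le> h" by simp
  moreover have "p \<in> low_paths h n i"
    using L ordp len i by (auto simp: low_paths_iff)
  ultimately show ?R using j by (intro conjI exI[of _ i]) auto
next
  assume ?R
  then obtain i where i: "k \<le> h" "p \<in> low_paths h n i" "i \<le> k + 1" "j = int k - int i" by blast
  have len: "length p = n" "sum_list p = int i" using i by (auto simp: low_paths_iff)
  have "0 \<le> ordinate (p @ [j]) l \<and> ordinate (p @ [j]) l \<le> int h" if "l \<le> Suc n" for l
  proof (cases "l = Suc n")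
    case True
    then show ?thesis using len i by (simp add: ordinate_def)
  next
    case False
    then have "l \<le> n" using that by simp
    then show ?thesis using i(2) len by (simp add: low_paths_iff ordinate_def)
  qed
  then show ?L using i len by (auto simp: low_paths_iff)
qed

lemma card_low_paths_Suc:
  assumes "k \<le> h"
  shows "card (low_paths h (Suc n) k) = (\<Sum>i\<le>k+1. card (low_paths h n i))"
proof -
  define ext where "ext i = (\<lambda>p. p @ [int k - int i])" for i
  have eq: "low_paths h (Suc n) k = (\<Union>i\<in>{..k+1}. ext i ` low_paths h n i)"
  proof (intro set_eqI iffI)
    fix q assume q: "q \<in> low_paths h (Suc n) k"
    then have "length q = Suc n" by (simp add: low_paths_iff)
    then obtain p j where "q = p @ [j]" by (metis length_Suc_conv_rev)
    with q show "q \<in> (\<Union>i\<in>{..k+1}. ext i ` low_paths h n i)"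
      unfolding ext_def by (auto simp: snoc_in_low_paths_iff)
  next
    fix q assume "q \<in> (\<Union>i\<in>{..k+1}. ext i ` low_paths h n i)"
    then show "q \<in> low_paths h (Suc n) k"
      unfolding ext_def using assms by (auto simp: snoc_in_low_paths_iff)
  qed
  have "card (low_paths h (Suc n) k) = (\<Sum>i\<le>k+1. card (ext i ` low_paths h n i))"
    unfolding eq
    by (rule card_UN_disjoint) (auto simp: finite_low_paths ext_def)
  also have "\<dots> = (\<Sum>i\<le>k+1. card (low_paths h n i))"
    by (intro sum.cong refl card_image) (auto simp: inj_on_def ext_def)
  finally show ?thesis .
qed

lemma low_paths_beyond: "k > h \<Longrightarrow> low_paths h n k = {}"
  by (fastforce simp: low_paths_iff ordinate_def)

lemma low_paths_0: "low_paths h 0 k = (if k = 0 then {[]} else {})"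
  by (auto simp: low_paths_iff ordinate_def)

section \<open>Counting by reflection\<close>

text \<open>
  Reflected end points may fall outside the range of a binomial coefficient on either side; with an
  integer lower index Pascal's rule holds for all of them.
\<close>

definition int_choose :: "nat \<Rightarrow> int \<Rightarrow> int" where
  "int_choose m i = (if i < 0 then 0 else int (m choose nat i))"

lemma int_choose_Suc: "int_choose (Suc m) i = int_choose m i + int_choose m (i - 1)"
proof (cases "i \<le> 0")
  case True
  then show ?thesis by (auto simp: int_choose_def)
next
  case False
  then have "nat i = Suc (nat (i - 1))" by simp
  then show ?thesis using False by (simp add: int_choose_def)
qed

lemma int_choose_eq_0: "i < 0 \<or> i > int m \<Longrightarrow> int_choose m i = 0"
  by (auto simp: int_choose_def)

lemma int_choose_symmetric: "int_choose m (int m - i) = int_choose m i"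
proof (cases "0 \<le> i \<and> i \<le> int m")
  case True
  then have "nat (int m - i) = m - nat i" "nat i \<le> m" by auto
  then show ?thesis using True by (simp add: int_choose_def binomial_symmetric[of "nat i" m])
next
  case False
  then show ?thesis by (auto simp: int_choose_eq_0)
qed

text \<open>
  Walls at \<open>-2\<close> and \<open>h + 1\<close> are at distance \<open>H = h + 3\<close>, and the composition of the two
  reflections shifts the number of up-steps by \<open>H\<close>. The sum over all integers \<open>j\<close> is cut off at \<open>L\<close>:
  one \<open>L\<close> serves all lengths up to \<open>L\<close>, which keeps the recurrence free of boundary terms.
\<close>

definition reflected_sum :: "nat \<Rightarrow> int \<Rightarrow> nat \<Rightarrow> int \<Rightarrow> int" where
  "reflected_sum L H m a = (\<Sum>j\<in>{-int L..int L}. int_choose m (a + j * H))"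

text \<open>
  The number of paths of length \<open>n + 1\<close>. A step \<open>j\<close> corresponds to \<open>j + 1\<close> up-steps
  followed by a down-step, the last of which is forced; this leaves \<open>2 n + k + 1\<close> unit steps, of
  which \<open>n + k + 1\<close> go up.
\<close>

definition strip_count :: "nat \<Rightarrow> int \<Rightarrow> nat \<Rightarrow> nat \<Rightarrow> int" where
  "strip_count L H n k =
     reflected_sum L H (2*n+k+1) (int n + int k + 1) - reflected_sum L H (2*n+k+1) (int n - 1)"

lemma reflected_sum_Suc:
  "reflected_sum L H (Suc m) a = reflected_sum L H m a + reflected_sum L H m (a - 1)"
  unfolding reflected_sum_def sum.distrib[symmetric]
  by (intro sum.cong refl) (simp add: int_choose_Suc algebra_simps)

lemma strip_count_step_0:
  "strip_count L H (Suc n) 0 = strip_count L H n 0 + strip_count L H n 1"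
  unfolding strip_count_def by (simp add: reflected_sum_Suc algebra_simps)

lemma strip_count_step_Suc:
  "strip_count L H (Suc n) (Suc k) = strip_count L H (Suc n) k + strip_count L H n (k + 2)"
  unfolding strip_count_def by (simp add: reflected_sum_Suc algebra_simps)

text \<open>
  Only Pascal's rule is used here: the wall at \<open>-2\<close> is built into the antisymmetric shape of
  \<open>strip_count\<close>. The sum includes \<open>i = k + 1\<close>, which for \<open>k = h\<close> lies on the upper wall.
\<close>

lemma strip_count_Suc:
  "strip_count L H (Suc n) k = (\<Sum>i\<le>k+1. strip_count L H n i)"
  by (induction k) (simp_all add: strip_count_step_0 strip_count_step_Suc)

text \<open>
  At the upper wall the two progressions differ by a shift by \<open>H\<close>, so that the difference telescopes to
  two terms, whose indices lie outside the range of the binomial coefficient because \<open>n < L\<close>.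
\<close>

lemma strip_count_wall:
  assumes "n < L"
  shows "strip_count L (int h + 3) n (Suc h) = 0"
proof -
  define H where "H = int h + 3"
  define m where "m = 2*n + Suc h + 1"
  define g where "g j = int_choose m (int n - 1 + j * H)" for j
  have "(\<Sum>j\<in>{-int L..int L}. g (j + 1)) = (\<Sum>j\<in>{-int L+1..int L+1}. g j)"
    by (rule sum.reindex_bij_witness[of _ "\<lambda>j. j - 1" "\<lambda>j. j + 1"]) auto
  also have "{-int L+1..int L+1} = insert (int L + 1) {-int L+1..int L}" by auto
  also have "(\<Sum>j\<in>\<dots>. g j) = g (int L + 1) + (\<Sum>j\<in>{-int L+1..int L}. g j)" by simp
  finally have 1: "(\<Sum>j\<in>{-int L..int L}. g (j + 1)) = \<dots>" .
  have "{-int L..int L} = insert (-int L) {-int L+1..int L}" by auto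
  then have 2: "(\<Sum>j\<in>{-int L..int L}. g j) = g (-int L) + (\<Sum>j\<in>{-int L+1..int L}. g j)" by simp
  have "int n * 3 \<le> int L * H" using assms by (intro mult_mono) (auto simp: H_def)
  then have "g (- int L) = 0" unfolding g_def
    by (intro int_choose_eq_0) auto
  have "int n < int L * H" using \<open>int n * 3 \<le> int L * H\<close> assms mult_pos_pos[of "int L" H]
    by (cases "n = 0") (auto simp: H_def)
  then have "g (int L + 1) = 0" unfolding g_def
    by (intro int_choose_eq_0 disjI2) (auto simp: m_def H_def algebra_simps)
  have "reflected_sum L H m (int n + int (Suc h) + 1) = (\<Sum>j\<in>{-int L..int L}. g (j + 1))"
    unfolding reflected_sum_def g_def by (simp add: H_def algebra_simps)
  moreover have "reflected_sum L H m (int n - 1) = (\<Sum>j\<in>{-int L..int L}. g j)"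
    unfolding reflected_sum_def g_def by simp
  ultimately have "reflected_sum L H m (int n + int (Suc h) + 1) = reflected_sum L H m (int n - 1)"
    using 1 2 \<open>g (- int L) = 0\<close> \<open>g (int L + 1) = 0\<close> by simp
  then show ?thesis by (simp add: strip_count_def m_def H_def)
qed

lemma strip_count_0:
  assumes "k \<le> h"
  shows "strip_count L (int h + 3) 0 k = 1"
proof -
  define H where "H = int h + 3"
  have zero: "int_choose (Suc k) (int k + 1 + j * H) = 0" if "j \<noteq> 0" for j
  proof (rule int_choose_eq_0)
    have "j \<ge> 1 \<or> j \<le> -1" using that by linarith
    then show "int k + 1 + j * H < 0 \<or> int k + 1 + j * H > int (Suc k)"
    proof
      assume "j \<ge> 1"
      then have "1 * H \<le> j * H" by (intro mult_right_mono) (auto simp: H_def)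
      then show ?thesis by (simp add: H_def)
    next
      assume "j \<le> -1"
      then have "j * H \<le> (-1) * H" by (intro mult_right_mono) (auto simp: H_def)
      then show ?thesis using assms by (simp add: H_def)
    qed
  qed
  have zero': "int_choose (Suc k) (j * H - 1) = 0" for j
  proof (rule int_choose_eq_0)
    consider "j \<ge> 1" | "j \<le> 0" by linarith
    then show "j * H - 1 < 0 \<or> j * H - 1 > int (Suc k)"
    proof cases
      case 1
      then have "1 * H \<le> j * H" by (intro mult_right_mono) (auto simp: H_def)
      then show ?thesis using assms H_def by linarith
    next
      case 2
      then have "j * H \<le> 0 * H" by (intro mult_right_mono) (auto simp: H_def)
      then show ?thesis by simp
    qed
  qed
  have "(\<Sum>j\<in>{-int L..int L}. int_choose (Suc k) (int k + 1 + j * H))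
      = (\<Sum>j\<in>{0}. int_choose (Suc k) (int k + 1 + j * H))"
    by (rule sum.mono_neutral_right) (auto simp: zero)
  also have "\<dots> = 1" by (simp add: int_choose_def nat_add_distrib)
  finally show ?thesis
    by (simp add: strip_count_def reflected_sum_def zero' flip: H_def)
qed

lemma card_low_paths:
  assumes "k \<le> h" "n < L"
  shows "int (card (low_paths h (Suc n) k)) = strip_count L (int h + 3) n k"
  using assms
proof (induction n arbitrary: k)
  case 0
  have "card (low_paths h (Suc 0) k) = (\<Sum>i\<le>k+1. if i = 0 then 1 else 0)"
    unfolding card_low_paths_Suc[OF 0(1)] by (intro sum.cong) (auto simp: low_paths_0)
  then show ?case using 0 by (simp add: strip_count_0 del: sum.atMost_Suc)
next
  case (Suc n)
  have "int (card (low_paths h (Suc n) i)) = strip_count L (int h + 3) n i" if "i \<le> k + 1" for i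
  proof (cases "i \<le> h")
    case True
    then show ?thesis using Suc by simp
  next
    case False
    then have "i = Suc h" using that Suc.prems by simp
    then show ?thesis using Suc.prems by (simp add: low_paths_beyond strip_count_wall)
  qed
  then have "(\<Sum>i\<le>k+1. int (card (low_paths h (Suc n) i))) = (\<Sum>i\<le>k+1. strip_count L (int h + 3) n i)"
    by (intro sum.cong) auto
  then show ?case using Suc.prems
    by (subst card_low_paths_Suc) (simp_all add: strip_count_Suc del: sum.atMost_Suc)
qed

section \<open>The proportion of high paths as a sum of second differences\<close>

lemma binomial_Suc_ratio: "real (i + 1) * real (m choose (i + 1)) = (real m - real i) * real (m choose i)"
proof (cases "i \<le> m")
  case True
  have "Suc i * (m choose Suc i) = (m - i) * (m choose i)"
    using binomial_absorb_comp[of m i] binomial_absorption[of i "m"] by (metis binomial_absorption)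
  then have "real (Suc i * (m choose Suc i)) = real ((m - i) * (m choose i))" by (rule arg_cong)
  then show ?thesis using True by (simp add: of_nat_diff algebra_simps del: binomial_Suc_Suc)
qed (simp add: binomial_eq_0)

text \<open>
  In terms of \<open>p = i + 2\<close> and \<open>q = M - p\<close>, the numerator over the common factor is
  \<open>p (p - 1) - 2 p q + q (q - 1) = (p - q)\<^sup>2 - M\<close>. This is the discrete form of the second
  derivative of a Gaussian.
\<close>

lemma binomial_second_difference:
  fixes m i :: nat
  defines "M \<equiv> m + 2"
  shows "real (m choose i) - 2 * real (m choose (i+1)) + real (m choose (i+2)) =
         real (M choose (i+2)) * ((2 * real (i+2) - real M)\<^sup>2 - real M) / (real M * (real M - 1))"
proof -
  define X Y Z where "X = real (m choose i)" "Y = real (m choose (i+1))" "Z = real (m choose (i+2))"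
  have XY: "(i + 1) * Y = (real m - i) * X" and YZ: "(real i + 2) * Z = (real m - i - 1) * Y"
    using binomial_Suc_ratio[of i m] binomial_Suc_ratio[of "i+1" m] by (simp_all add: X_Y_Z_def algebra_simps)
  have Y: "Y = (real m - i) * X / (i + 1)" using XY by (simp add: field_simps)
  have Z: "Z = (real m - i - 1) * Y / (i + 2)" using YZ by (simp add: field_simps)
  have C: "real (M choose (i+2)) = X + 2 * Y + Z"
    by (simp add: M_def X_Y_Z_def numeral_2_eq_2)
  have "(real i + 1) * (real i + 2) * ((X - 2*Y + Z) * (real M * (real M - 1)) - (X + 2*Y + Z) * ((2 * real (i+2) - real M)\<^sup>2 - real M)) = 0"
    unfolding Z Y by (simp add: M_def divide_simps) algebra
  moreover have "(real i + 1) * (real i + 2) \<noteq> 0" by (simp add: add_nonneg_eq_0_iff)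
  ultimately have "(X - 2*Y + Z) * (real M * (real M - 1)) = (X + 2*Y + Z) * ((2 * real (i+2) - real M)\<^sup>2 - real M)"
    by simp
  moreover have "real M * (real M - 1) \<noteq> 0" by (simp add: M_def)
  ultimately show ?thesis unfolding C X_Y_Z_def[symmetric]
    by (simp only: eq_divide_eq not_False_eq_True if_True)
qed

lemma sum_symmetric_int_interval:
  fixes g :: "int \<Rightarrow> int"
  shows "(\<Sum>j\<in>{-int L..int L}. g j) = g 0 + (\<Sum>j=1..L. g (int j) + g (- int j))"
proof (induction L)
  case (Suc L)
  have "{-int (Suc L)..int (Suc L)} = insert (int (Suc L)) (insert (- int (Suc L)) {-int L..int L})"
    by auto
  then show ?case using Suc by simp
qed simp

text \<open>
  Up to a shift of \<open>t\<close> by a bounded amount this is the binomial distribution relative to its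
  value at the centre, so it behaves like \<open>exp (- t\<^sup>2 / n)\<close>.
\<close>

definition binom_ratio :: "nat \<Rightarrow> nat \<Rightarrow> nat \<Rightarrow> real" where
  "binom_ratio k n t =
     real ((2*n+k+1) choose (n + t - 1)) / real ((2*n+k+1) choose (n - 1))"

text \<open>
  The contribution of the reflections \<open>j\<close> and \<open>-j\<close>, divided by the total number of paths and
  written at \<open>y = j * H\<close>. Reflection produces the difference of two first differences at distance
  \<open>k + 2\<close>; these are \<open>k + 2\<close> consecutive second differences, whence the sum over \<open>l\<close>.
\<close>

definition tail_term :: "nat \<Rightarrow> nat \<Rightarrow> nat \<Rightarrow> real" where
  "tail_term k n y =
     (\<Sum>l\<le>k+1. binom_ratio k n (y + l + 1) *
        (((2 * real y + 2 * real l - real k - 1)\<^sup>2 - real (2*n+k+1)) / real (n+k+2))) / real (k+2)"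

lemma path_height_le:
  assumes "p \<in> lukasiewicz_paths n k"
  shows "path_height p \<le> int (n + k)"
  unfolding path_height_le_iff
proof (intro allI impI)
  fix i assume i: "i \<le> length p"
  have "\<forall>j\<in>set (drop i p). j \<ge> -1"
    using assms set_drop_subset[of i p] by (auto simp: lukasiewicz_paths_def partial_lukasiewicz_def)
  from step_le_sum_list[OF this] have "sum_list (drop i p) \<ge> - int n"
    using assms by (auto simp: lukasiewicz_paths_def)
  moreover have "sum_list (take i p) + sum_list (drop i p) = int k"
    using assms unfolding sum_list_append[symmetric]
    by (auto simp: lukasiewicz_paths_def ordinate_def)
  ultimately show "ordinate p i \<le> int (n + k)" by (simp add: ordinate_def)
qed

text \<open>
  With \<open>h\<close> at least the maximal possible height the strip is no restriction, and every term with
  \<open>j \<noteq> 0\<close> vanishes.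
\<close>

lemma card_lukasiewicz_paths_int:
  "int (card (lukasiewicz_paths (Suc n) k)) =
     int_choose (2*n+k+1) (int n + int k + 1) - int_choose (2*n+k+1) (int n - 1)"
proof -
  define h where "h = Suc n + k"
  define H where "H = int h + 3"
  have "lukasiewicz_paths (Suc n) k = low_paths h (Suc n) k"
    using path_height_le[of _ "Suc n" k] unfolding low_paths_def h_def by blast
  then have "int (card (lukasiewicz_paths (Suc n) k)) = strip_count (Suc n) H n k"
    using card_low_paths[of k h n "Suc n"] by (simp add: h_def H_def)
  have far: "j * H \<ge> H \<or> j * H \<le> - H" if "j \<noteq> 0" for j
  proof -
    have "j \<ge> 1 \<or> j \<le> -1" using that by linarith
    then show ?thesis
      using mult_right_mono[of 1 j H] mult_right_mono[of j "-1" H] by (auto simp: H_def)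
  qed
  have H: "H = int n + int k + 4" by (simp add: H_def h_def)
  have vanish: "int_choose (2*n+k+1) (int n + int k + 1 + q) = 0"
    "int_choose (2*n+k+1) (int n - 1 + q) = 0" if "q \<ge> H \<or> q \<le> - H" for q
    using that unfolding H by (intro int_choose_eq_0; auto)+
  have z: "int_choose (2*n+k+1) (int n + int k + 1 + j * H) = 0"
    "int_choose (2*n+k+1) (int n - 1 + j * H) = 0" if "j \<noteq> 0" for j
    using vanish[OF far[OF that]] by simp_all
  show ?thesis
    unfolding \<open>int (card (lukasiewicz_paths (Suc n) k)) = _\<close> strip_count_def reflected_sum_def
      sum_symmetric_int_interval
    using z z[of "- int j" for j] by simp
qed

text \<open>
  The total is expressed with the same binomial coefficient and the same denominator as
  \<open>binomial_second_difference\<close>, so that both cancel in the quotient.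
\<close>

lemma card_lukasiewicz_paths:
  fixes n k :: nat
  assumes "n \<ge> 1"
  defines "M \<equiv> 2*n+k+1"
  shows "real (card (lukasiewicz_paths n k)) =
     real (M choose (n - 1)) * real (n+k+2) * real (k+2) / (real M * (real M - 1))"
proof -
  obtain n' where n': "n = Suc n'" using assms by (cases n) auto
  define m where "m = 2*n'+k+1"
  define X where "X = real (m choose n')"
  have M: "M = m + 2" by (simp add: M_def m_def n')
  have "int_choose m (int n' + int k + 1) = int_choose m (int m - int n')"
    by (simp add: m_def add_ac)
  then have 1: "int_choose m (int n' + int k + 1) = int (m choose n')"
    unfolding int_choose_symmetric by (simp add: int_choose_def)
  have 2: "(real n' + k + 2) * of_int (int_choose m (int n' - 1)) = n' * X"
  proof (cases n')
    case 0
    then show ?thesis by (simp add: int_choose_def)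
  next
    case (Suc i)
    then have "int_choose m (int n' - 1) = int (m choose i)" by (simp add: int_choose_def)
    then show ?thesis using binomial_Suc_ratio[of i m] Suc by (simp add: X_def m_def algebra_simps)
  qed
  have "(Suc m - n') * (Suc m choose n') = Suc m * (m choose n')"
    and "(M - n') * (M choose n') = M * (Suc m choose n')"
    using binomial_absorb_comp[of "Suc m" n'] binomial_absorb_comp[of M n'] by (simp_all add: M)
  then have "(M - n') * (Suc m - n') * (M choose n') = M * Suc m * (m choose n')"
    by (metis mult.assoc mult.left_commute)
  moreover have "M - n' = n' + k + 3" "Suc m - n' = n' + k + 2" by (simp_all add: M m_def)
  ultimately have "real ((n' + k + 3) * (n' + k + 2) * (M choose n')) = real (M * Suc m * (m choose n'))"
    by simp
  then have 3: "(real n' + k + 3) * (real n' + k + 2) * real (M choose n') = real M * (real M - 1) * X"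
    by (simp add: X_def M algebra_simps)
  have "int (card (lukasiewicz_paths n k)) = int (m choose n') - int_choose m (int n' - 1)"
    unfolding 1[symmetric] unfolding n' m_def by (rule card_lukasiewicz_paths_int)
  then have "real_of_int (int (card (lukasiewicz_paths n k))) =
      real_of_int (int (m choose n') - int_choose m (int n' - 1))" by (rule arg_cong)
  then have 4: "real (card (lukasiewicz_paths n k)) = X - of_int (int_choose m (int n' - 1))"
    by (simp add: X_def)
  have "(real n' + k + 2) * real (card (lukasiewicz_paths n k)) = (k + 2) * X"
    unfolding 4 right_diff_distrib 2 by (simp add: algebra_simps)
  then have "real (card (lukasiewicz_paths n k)) = (k + 2) * X / (real n' + k + 2)"
    by (simp add: field_simps)
  also have "\<dots> = (k + 2) * (real n' + k + 3) * real (M choose n') / (real M * (real M - 1))"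
  proof -
    have "real M * (real M - 1) \<noteq> 0" by (simp add: M)
    then have "X = (real n' + k + 3) * (real n' + k + 2) * real (M choose n') / (real M * (real M - 1))"
      using 3 by (simp add: field_simps)
    moreover have "c * (b * a * C / D) / a = c * b * C / D" if "a \<noteq> 0" for a b c C D :: real
      using that by simp
    ultimately show ?thesis by (simp only:)
  qed
  finally show ?thesis by (simp add: n' mult_ac add_ac)
qed

lemma proportion_of_high_paths:
  assumes "n \<ge> 1" "k \<le> h"
  shows "1 - real (card (low_paths h n k)) / real (card (lukasiewicz_paths n k)) =
         (\<Sum>j=1..n. tail_term k n (j * (h + 3)))"
proof -
  obtain n' where n': "n = Suc n'" using assms by (cases n) auto
  define m M where "m = 2*n'+k+1" and "M = 2*n+k+1"
  define H where "H = int h + 3"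
  have M: "M = m + 2" by (simp add: M_def m_def n')
  define T where "T = real (card (lukasiewicz_paths n k))"
  define c where "c = int_choose m"
  define \<psi> where "\<psi> y = c (int n' - 1 + y) + c (int n' - 1 - y)
    - c (int n' + int k + 1 + y) - c (int n' + int k + 1 - y)" for y
  have T: "T = real (M choose (n - 1)) * real (n+k+2) * real (k+2) / (real M * (real M - 1))"
    unfolding T_def M_def using card_lukasiewicz_paths[OF assms(1)] by simp
  have "n - 1 \<le> M" by (simp add: M_def)
  have pos: "real (M choose (n - 1)) > 0" "real M * (real M - 1) > 0" "T > 0"
    unfolding T using \<open>n - 1 \<le> M\<close> by (auto simp: M intro!: divide_pos_pos mult_pos_pos)
  have "int (card (low_paths h n k)) = strip_count n H n' k"
    unfolding n' H_def using assms by (intro card_low_paths) auto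
  also have "\<dots> = int (card (lukasiewicz_paths n k)) - (\<Sum>j=1..n. \<psi> (int j * H))"
    unfolding strip_count_def reflected_sum_def sum_symmetric_int_interval
    unfolding n' card_lukasiewicz_paths_int m_def[symmetric] c_def[symmetric] \<psi>_def
    by (simp add: sum.distrib sum_subtractf algebra_simps)
  finally have "real_of_int (int (card (low_paths h n k))) =
      real_of_int (int (card (lukasiewicz_paths n k)) - (\<Sum>j=1..n. \<psi> (int j * H)))"
    by (rule arg_cong)
  then have "T - real (card (low_paths h n k)) = (\<Sum>j=1..n. of_int (\<psi> (int j * H)))"
    unfolding T_def by simp
  moreover have "of_int (\<psi> (int (j * (h + 3)))) = T * tail_term k n (j * (h + 3))" if "j \<ge> 1" for j
  proof -
    define y where "y = j * (h + 3)"
    have "y \<ge> 1" using that by (simp add: y_def)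
    define d where "d l = c (int n' - 1 + int y + int l) - c (int n' + int y + int l)" for l
    \<comment> \<open>The symmetry of the binomial coefficient moves the indices \<open>- y\<close> to the upper half.\<close>
    have s1: "c (int n' - 1 - int y) = c (int n' + int k + 2 + int y)"
      unfolding c_def using int_choose_symmetric[of m "int n' - 1 - int y"] by (simp add: m_def algebra_simps)
    have s2: "c (int n' + int k + 1 - int y) = c (int n' + int y)"
      unfolding c_def using int_choose_symmetric[of m "int n' + int k + 1 - int y"] by (simp add: m_def algebra_simps)
    have "\<psi> (int y) = d 0 - d (k + 2)"
      unfolding \<psi>_def s1 s2 d_def by (simp add: algebra_simps)
    also have "\<dots> = (\<Sum>l\<le>k+1. d l - d (Suc l))"
      by (subst sum_telescope) simp
    finally have "of_int (\<psi> (int y)) = (\<Sum>l\<le>k+1. real_of_int (d l - d (Suc l)))" by simp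
    also have "\<dots> = (\<Sum>l\<le>k+1. real (M choose (n + y + l)) *
        ((2 * real y + 2 * real l - real k - 1)\<^sup>2 - real M) / (real M * (real M - 1)))"
    proof (intro sum.cong refl)
      fix l
      define i where "i = n' + y + l - 1"
      have i: "int n' - 1 + int y + int l = int i" using \<open>y \<ge> 1\<close> by (simp add: i_def)
      have "d l - d (Suc l) = c (int i) - 2 * c (int i + 1) + c (int i + 2)"
        unfolding d_def i[symmetric] by (simp add: algebra_simps)
      then have "real_of_int (d l - d (Suc l)) =
          real (m choose i) - 2 * real (m choose (i+1)) + real (m choose (i+2))"
        by (simp add: c_def int_choose_def nat_add_distrib)
      also have "\<dots> = real (M choose (i + 2)) * ((2 * real (i + 2) - real M)\<^sup>2 - real M) / (real M * (real M - 1))"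
        unfolding M by (rule binomial_second_difference)
      also have "i + 2 = n + y + l" using \<open>y \<ge> 1\<close> by (simp add: i_def n')
      also have "2 * real (n + y + l) - real M = 2 * real y + 2 * real l - real k - 1"
        by (simp add: M_def)
      finally show "real_of_int (d l - d (Suc l)) = real (M choose (n + y + l)) *
        ((2 * real y + 2 * real l - real k - 1)\<^sup>2 - real M) / (real M * (real M - 1))" .
    qed
    also have "\<dots> = T * tail_term k n y"
    proof -
      have "T * tail_term k n y = T / real (k+2) * (\<Sum>l\<le>k+1. binom_ratio k n (y + l + 1) *
        (((2 * real y + 2 * real l - real k - 1)\<^sup>2 - real M) / real (n+k+2)))"
        unfolding tail_term_def M_def by (simp only: times_divide_eq_right times_divide_eq_left)
      also have "\<dots> = (\<Sum>l\<le>k+1. T / real (k+2) * (binom_ratio k n (y + l + 1) *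
        (((2 * real y + 2 * real l - real k - 1)\<^sup>2 - real M) / real (n+k+2))))"
        by (rule sum_distrib_left)
      also have "\<dots> = (\<Sum>l\<le>k+1. real (M choose (n + y + l)) *
        ((2 * real y + 2 * real l - real k - 1)\<^sup>2 - real M) / (real M * (real M - 1)))"
      proof (intro sum.cong refl)
        fix l
        define q where "q = (2 * real y + 2 * real l - real k - 1)\<^sup>2 - real M"
        have "T / real (k+2) * (binom_ratio k n (y + l + 1) * (q / real (n+k+2))) =
            (T / (real (k+2) * real (n+k+2) * real (M choose (n - 1)))) * real (M choose (n + y + l)) * q"
        proof -
          have "n + (y + l + 1) - 1 = n + y + l" by simp
          then show ?thesis unfolding binom_ratio_def M_def[symmetric] by (simp only:) (simp add: mult_ac)
        qed
        also have "T / (real (k+2) * real (n+k+2) * real (M choose (n - 1))) = 1 / (real M * (real M - 1))"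
        proof -
          have "T = real (k+2) * real (n+k+2) * real (M choose (n - 1)) / (real M * (real M - 1))"
            unfolding T by (simp add: mult_ac)
          moreover have "real (k+2) * real (n+k+2) * real (M choose (n - 1)) > 0"
            using pos(1) by (intro mult_pos_pos) auto
          ultimately show ?thesis using \<open>n - 1 \<le> M\<close> by simp
        qed
        finally show "T / real (k+2) * (binom_ratio k n (y + l + 1) * (q / real (n+k+2))) =
          real (M choose (n + y + l)) * q / (real M * (real M - 1))" by simp
      qed
      finally show ?thesis by simp
    qed
    finally show ?thesis by (simp add: y_def)
  qed
  ultimately have "T - real (card (low_paths h n k)) = T * (\<Sum>j=1..n. tail_term k n (j * (h + 3)))"
    unfolding sum_distrib_left H_def by (auto intro!: sum.cong)
  then have "(T - real (card (low_paths h n k))) / T = (\<Sum>j=1..n. tail_term k n (j * (h + 3)))"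
    using pos(3) by simp
  then show ?thesis using pos(3) unfolding T_def by (simp add: diff_divide_distrib)
qed

section \<open>Local limit and uniform bound\<close>

lemma binom_ratio_nonneg: "binom_ratio k n t \<ge> 0"
  by (simp add: binom_ratio_def)

lemma binom_ratio_Suc:
  assumes "n \<ge> 1"
  shows "binom_ratio k n (Suc t) =
         binom_ratio k n t * (1 + (real k + 2 - 2 * real t) / (real n + real t))"
proof -
  define m where "m = 2*n+k+1"
  have "real (n + t - 1 + 1) * real (m choose (n + t - 1 + 1)) =
      (real m - real (n + t - 1)) * real (m choose (n + t - 1))"
    by (rule binomial_Suc_ratio)
  moreover have "n + t - 1 + 1 = n + t" "real m - real (n + t - 1) = real n + k + 2 - t"
    using assms by (auto simp: m_def of_nat_diff)
  ultimately have "(real n + t) * real (m choose (n + t)) =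
      (real n + k + 2 - t) * real (m choose (n + t - 1))" by simp
  moreover have "real n + t > 0" using assms by simp
  ultimately have "real (m choose (n + t)) =
      real (m choose (n + t - 1)) * (1 + (real k + 2 - 2 * real t) / (real n + real t))"
    by (simp add: field_simps)
  then show ?thesis by (simp add: binom_ratio_def m_def)
qed

lemma binom_ratio_prod:
  assumes "n \<ge> 1"
  shows "binom_ratio k n t = (\<Prod>i<t. 1 + (real k + 2 - 2 * real i) / (real n + real i))"
proof (induction t)
  case 0
  then show ?case using assms by (simp add: binom_ratio_def)
qed (simp add: binom_ratio_Suc[OF assms])

lemma sum_twice_lessThan: "(\<Sum>i<t. 2 * real i) = real t * (real t - 1)"
  by (induction t) (auto simp: algebra_simps)

text \<open>
  Each factor of \<open>binom_ratio\<close> is bounded by an exponential. The exponents sum to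
  \<open>- t\<^sup>2 / (2 n + k + 2)\<close> up to a bounded error, as long as \<open>t \<le> n + k + 2\<close>; beyond that the
  binomial coefficient is zero.
\<close>

lemma binom_ratio_le:
  assumes "n \<ge> 1"
  shows "binom_ratio k n t \<le>
         exp ((real k + 2) * (real k + 3) + 1) * exp (- ((real t)\<^sup>2 / ((real k + 4) * real n)))"
proof (cases "t \<le> n + k + 2")
  case True
  define x where "x i = (real k + 2 - 2 * real i) / (real n + real i)" for i
  have "binom_ratio k n t \<le> exp (\<Sum>i<t. x i)" for t
  proof (induction t)
    case 0
    then show ?case using assms by (simp add: binom_ratio_def)
  next
    case (Suc t)
    have "binom_ratio k n (Suc t) = binom_ratio k n t * (1 + x t)"
      unfolding x_def by (rule binom_ratio_Suc[OF assms])
    also have "\<dots> \<le> binom_ratio k n t * exp (x t)"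
      by (intro mult_left_mono binom_ratio_nonneg exp_ge_add_one_self)
    also have "\<dots> \<le> exp (\<Sum>i<t. x i) * exp (x t)"
      using Suc by (intro mult_right_mono) auto
    finally show ?case by (simp add: exp_add)
  qed
  also have "exp (\<Sum>i<t. x i) \<le> exp ((real k + 2) * (real k + 3) + 1 - (real t)\<^sup>2 / ((real k + 4) * real n))"
  proof -
    have "x i \<le> (real k + 2) / n - 2 * real i / (2 * n + k + 2)" if "i < t" for i
    proof -
      have "(real k + 2) / (real n + i) \<le> (real k + 2) / n"
        using assms by (intro divide_left_mono) auto
      moreover have "2 * real i / (2 * n + k + 2) \<le> 2 * real i / (real n + i)"
        using assms that True by (intro divide_left_mono) auto
      ultimately show ?thesis unfolding x_def diff_divide_distrib by linarith
    qed
    then have "(\<Sum>i<t. x i) \<le> (\<Sum>i<t. (real k + 2) / n - 2 * real i / (2 * n + k + 2))"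
      by (intro sum_mono) auto
    also have "\<dots> = t * ((real k + 2) / n) - t * (real t - 1) / (2 * n + k + 2)"
      by (simp add: sum_subtractf sum_divide_distrib[symmetric] sum_twice_lessThan)
    also have "t * (real t - 1) / (2 * n + k + 2) = (real t)\<^sup>2 / (2 * n + k + 2) - t / (2 * n + k + 2)"
      by (simp add: diff_divide_distrib[symmetric] power2_eq_square algebra_simps)
    also have "t * ((real k + 2) / n) - ((real t)\<^sup>2 / (2 * n + k + 2) - t / (2 * n + k + 2))
      \<le> (real k + 2) * (real k + 3) - ((real t)\<^sup>2 / ((real k + 4) * n) - 1)"
    proof (rule diff_mono)
      have "real t \<le> (real k + 3) * n"
      proof -
        have "real t \<le> n + k + 2" using True by simp
        also have "\<dots> \<le> real n + (k + 2) * n"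
          using mult_right_mono[of 1 "real n" "real k + 2"] assms by (simp add: algebra_simps)
        finally show ?thesis by (simp add: algebra_simps)
      qed
      then have "real t * (real k + 2) \<le> ((real k + 3) * n) * (real k + 2)"
        by (intro mult_right_mono) auto
      then show "t * ((real k + 2) / n) \<le> (real k + 2) * (real k + 3)"
        using assms by (simp add: field_simps)
      have "t / (2 * n + k + 2) \<le> (1::real)" using True by simp
      moreover have "(real t)\<^sup>2 / ((real k + 4) * n) \<le> (real t)\<^sup>2 / (2 * n + k + 2)"
      proof (intro divide_left_mono)
        have "real (k + 2) * 1 \<le> real (k + 2) * n" using assms by (intro mult_left_mono) auto
        then show "real (2 * n + k + 2) \<le> (real k + 4) * n" by (simp add: algebra_simps)
      qed (use assms in auto)
      ultimately show "(real t)\<^sup>2 / ((real k + 4) * n) - 1 \<le> (real t)\<^sup>2 / (2 * n + k + 2) - t / (2 * n + k + 2)"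
        by linarith
    qed
    finally show ?thesis by simp
  qed
  finally show ?thesis by (simp add: exp_add[symmetric])
next
  case False
  then show ?thesis by (simp add: binom_ratio_def binomial_eq_0)
qed

text \<open>
  The logarithm of the factor of index \<open>i\<close> is \<open>- 2 i / n\<close> up to \<open>O(1 / n + i\<^sup>2 / n\<^sup>2)\<close>. For
  \<open>t\<close> of order \<open>sqrt n\<close> the total error is \<open>O(1 / sqrt n)\<close>.
\<close>

lemma ln_binom_ratio_approx:
  assumes "n \<ge> 1" "2 * (real k + 2 + 2 * real t) \<le> n"
  defines "D \<equiv> (real k + 2) + 4 * (real k + 2)\<^sup>2"
  shows "binom_ratio k n t > 0"
    and "\<bar>ln (binom_ratio k n t) + real t * (real t - 1) / n\<bar> \<le> t * (D / n + 18 * (real t)\<^sup>2 / (real n)\<^sup>2)"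
proof -
  define x where "x i = (real k + 2 - 2 * real i) / (real n + real i)" for i
  have n: "real n \<ge> 1" using assms by simp
  have x: "\<bar>x i\<bar> \<le> (real k + 2 + 2 * i) / n" for i
    unfolding x_def abs_divide using assms by (intro frac_le) auto
  have half: "\<bar>x i\<bar> \<le> 1/2" if "i < t" for i
  proof -
    have "(real k + 2 + 2 * i) / n \<le> 1/2"
      using that assms by (simp add: field_simps)
    then show ?thesis using x[of i] by linarith
  qed
  have pos: "1 + x i > 0" if "i < t" for i using half[OF that] by linarith
  have R: "binom_ratio k n t = (\<Prod>i<t. 1 + x i)"
    unfolding x_def by (rule binom_ratio_prod[OF assms(1)])
  show "binom_ratio k n t > 0" unfolding R using pos by (intro prod_pos) auto
  have "ln (binom_ratio k n t) = (\<Sum>i<t. ln (1 + x i))"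
    unfolding R by (intro ln_prod) (auto dest: pos)
  then have "ln (binom_ratio k n t) + real t * (real t - 1) / n = (\<Sum>i<t. ln (1 + x i) + 2 * real i / n)"
    by (simp add: sum.distrib sum_divide_distrib[symmetric] sum_twice_lessThan)
  also have "\<bar>\<dots>\<bar> \<le> (\<Sum>i<t. D / n + 18 * (real t)\<^sup>2 / (real n)\<^sup>2)"
  proof (intro order_trans[OF sum_abs] sum_mono)
    fix i assume "i \<in> {..<t}"
    then have i: "i < t" by simp
    have "x i + 2 * real i / n = (real k + 2) / (real n + i) + 2 * (real i)\<^sup>2 / (n * (real n + i))"
      using n unfolding x_def by (simp add: divide_simps add_nonneg_eq_0_iff) (simp add: algebra_simps power2_eq_square)
    moreover have "(real k + 2) / (real n + i) \<le> (real k + 2) / n"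
      using n by (intro divide_left_mono) auto
    moreover have "2 * (real i)\<^sup>2 / (n * (real n + i)) \<le> 2 * (real t)\<^sup>2 / (real n)\<^sup>2"
      using n i by (intro frac_le) (auto simp: power2_eq_square intro: mult_mono)
    moreover have "(real k + 2) / (real n + i) \<ge> 0" "2 * (real i)\<^sup>2 / (n * (real n + i)) \<ge> 0"
      by simp_all
    ultimately have 1: "\<bar>x i + 2 * real i / n\<bar> \<le> (real k + 2) / n + 2 * (real t)\<^sup>2 / (real n)\<^sup>2"
      by linarith
    have "(x i)\<^sup>2 \<le> ((real k + 2 + 2 * t) / n)\<^sup>2"
    proof -
      have "(real k + 2 + 2 * i) / n \<le> (real k + 2 + 2 * t) / n"
        using i by (intro divide_right_mono) auto
      then have "\<bar>x i\<bar>\<^sup>2 \<le> ((real k + 2 + 2 * t) / n)\<^sup>2"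
        using x[of i] by (intro power_mono) auto
      then show ?thesis by simp
    qed
    also have "\<dots> \<le> (2 * (real k + 2)\<^sup>2 + 8 * (real t)\<^sup>2) / (real n)\<^sup>2"
      unfolding power_divide
      using sum_squares_ge_zero[of "real k + 2 - 2 * t" 0]
      by (intro divide_right_mono) (auto simp: power2_eq_square algebra_simps)
    also have "\<dots> = 2 * (real k + 2)\<^sup>2 / (real n)\<^sup>2 + 8 * (real t)\<^sup>2 / (real n)\<^sup>2"
      by (simp add: add_divide_distrib)
    also have "2 * (real k + 2)\<^sup>2 / (real n)\<^sup>2 \<le> 2 * (real k + 2)\<^sup>2 / n"
      using n by (intro divide_left_mono) (auto simp: power2_eq_square)
    finally have 2: "(x i)\<^sup>2 \<le> 2 * (real k + 2)\<^sup>2 / n + 8 * (real t)\<^sup>2 / (real n)\<^sup>2" by simp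
    have "\<bar>ln (1 + x i) - x i\<bar> \<le> 2 * (x i)\<^sup>2"
      using half[OF i] by (rule abs_ln_one_plus_x_minus_x_bound)
    then have "\<bar>ln (1 + x i) + 2 * real i / n\<bar> \<le> 2 * (x i)\<^sup>2 + \<bar>x i + 2 * real i / n\<bar>" by linarith
    also have "\<dots> \<le> 2 * (2 * (real k + 2)\<^sup>2 / n + 8 * (real t)\<^sup>2 / (real n)\<^sup>2)
        + ((real k + 2) / n + 2 * (real t)\<^sup>2 / (real n)\<^sup>2)"
      by (intro add_mono mult_left_mono 1 2) auto
    also have "\<dots> = D / n + 18 * (real t)\<^sup>2 / (real n)\<^sup>2"
      by (simp add: D_def add_divide_distrib)
    finally show "\<bar>ln (1 + x i) + 2 * real i / n\<bar> \<le> D / n + 18 * (real t)\<^sup>2 / (real n)\<^sup>2" .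
  qed
  finally show "\<bar>ln (binom_ratio k n t) + real t * (real t - 1) / n\<bar> \<le> t * (D / n + 18 * (real t)\<^sup>2 / (real n)\<^sup>2)"
    by simp
qed

lemma inverse_sqrt_tendsto_0: "(\<lambda>n. 1 / sqrt (real n)) \<longlonglongrightarrow> 0"
  by real_asymp

lemma binom_ratio_tendsto:
  fixes t :: "nat \<Rightarrow> nat"
  assumes "(\<lambda>n. real (t n) / sqrt (real n)) \<longlonglongrightarrow> u"
  shows "(\<lambda>n. binom_ratio k n (t n)) \<longlonglongrightarrow> exp (- u\<^sup>2)"
proof -
  define s where "s n = real (t n) / sqrt (real n)" for n
  define v where "v n = 1 / sqrt (real n)" for n
  define D where "D = (real k + 2) + 4 * (real k + 2)\<^sup>2"
  have s: "s \<longlonglongrightarrow> u" using assms by (simp add: s_def[abs_def])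
  have v: "v \<longlonglongrightarrow> 0" unfolding v_def[abs_def] by (rule inverse_sqrt_tendsto_0)
  have "(\<lambda>n. 2 * ((real k + 2) * (v n)\<^sup>2 + 2 * (s n * v n))) \<longlonglongrightarrow> 2 * ((real k + 2) * 0\<^sup>2 + 2 * (u * 0))"
    by (intro tendsto_intros s v)
  then have "eventually (\<lambda>n. 2 * ((real k + 2) * (v n)\<^sup>2 + 2 * (s n * v n)) < 1) sequentially"
    by (rule order_tendstoD) simp
  then have small: "eventually (\<lambda>n. n \<ge> 1 \<and> 2 * (real k + 2 + 2 * real (t n)) \<le> n) sequentially"
    using eventually_ge_at_top[of 1]
  proof eventually_elim
    case (elim n)
    have "sqrt (real n) * sqrt (real n) = n" by simp
    then have "2 * ((real k + 2) * (v n)\<^sup>2 + 2 * (s n * v n)) = 2 * (real k + 2 + 2 * real (t n)) / n"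
      unfolding s_def v_def by (simp add: power2_eq_square add_divide_distrib)
    with elim have "2 * (real k + 2 + 2 * real (t n)) / n < 1" by simp
    then show ?case using elim by (simp add: divide_less_eq)
  qed
  have "(\<lambda>n. ln (binom_ratio k n (t n)) + ((s n)\<^sup>2 - s n * v n)) \<longlonglongrightarrow> 0"
  proof (rule Lim_null_comparison)
    show "eventually (\<lambda>n. norm (ln (binom_ratio k n (t n)) + ((s n)\<^sup>2 - s n * v n)) \<le>
      D * (s n * v n) + 18 * (s n ^ 3 * v n)) sequentially"
      using small
    proof eventually_elim
      case (elim n)
      have sq: "sqrt (real n) * sqrt (real n) = n" by simp
      have "(s n)\<^sup>2 - s n * v n = real (t n) * (real (t n) - 1) / n"
        unfolding s_def v_def using sq by (simp add: power2_eq_square diff_divide_distrib algebra_simps)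
      moreover have "t n * (D / n + 18 * (real (t n))\<^sup>2 / (real n)\<^sup>2) = D * (s n * v n) + 18 * (s n ^ 3 * v n)"
      proof -
        define r where "r = sqrt (real n)"
        have r: "real n = r * r" "r > 0" using elim by (auto simp: r_def)
        show ?thesis unfolding s_def v_def r_def[symmetric] r(1)
          using r(2) by (simp add: field_simps power2_eq_square power3_eq_cube)
      qed
      ultimately show ?case
        using ln_binom_ratio_approx(2)[of n k "t n"] elim by (simp add: D_def)
    qed
    have "(\<lambda>n. D * (s n * v n) + 18 * (s n ^ 3 * v n)) \<longlonglongrightarrow> D * (u * 0) + 18 * (u ^ 3 * 0)"
      by (intro tendsto_intros s v)
    then show "(\<lambda>n. D * (s n * v n) + 18 * (s n ^ 3 * v n)) \<longlonglongrightarrow> 0" by simp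
  qed
  moreover have "(\<lambda>n. (s n)\<^sup>2 - s n * v n) \<longlonglongrightarrow> u\<^sup>2 - u * 0"
    by (intro tendsto_intros s v)
  ultimately have "(\<lambda>n. ln (binom_ratio k n (t n)) + ((s n)\<^sup>2 - s n * v n) - ((s n)\<^sup>2 - s n * v n)) \<longlonglongrightarrow> 0 - (u\<^sup>2 - u * 0)"
    by (rule tendsto_diff)
  then have "(\<lambda>n. exp (ln (binom_ratio k n (t n)))) \<longlonglongrightarrow> exp (- u\<^sup>2)"
    by (intro tendsto_exp) simp
  moreover have "eventually (\<lambda>n. exp (ln (binom_ratio k n (t n))) = binom_ratio k n (t n)) sequentially"
    using small by eventually_elim (auto intro!: exp_ln ln_binom_ratio_approx(1))
  ultimately show ?thesis by (rule Lim_transform_eventually)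
qed

lemma tail_term_tendsto:
  fixes y :: "nat \<Rightarrow> nat"
  assumes y: "(\<lambda>n. real (y n) / sqrt (real n)) \<longlonglongrightarrow> u"
  shows "(\<lambda>n. tail_term k n (y n)) \<longlonglongrightarrow> (4 * u\<^sup>2 - 2) * exp (- u\<^sup>2)"
proof -
  define s where "s n = real (y n) / sqrt (real n)" for n
  define v where "v n = 1 / sqrt (real n)" for n
  have s: "s \<longlonglongrightarrow> u" using y by (simp add: s_def[abs_def])
  have v: "v \<longlonglongrightarrow> 0" unfolding v_def[abs_def] by (rule inverse_sqrt_tendsto_0)
  have "(\<lambda>n. binom_ratio k n (y n + l + 1) *
        (((2 * real (y n) + 2 * real l - real k - 1)\<^sup>2 - real (2*n+k+1)) / real (n+k+2)))
      \<longlonglongrightarrow> exp (- u\<^sup>2) * (4 * u\<^sup>2 - 2)" for l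
  proof (intro tendsto_mult binom_ratio_tendsto)
    have "(\<lambda>n. s n + (real l + 1) * v n) \<longlonglongrightarrow> u + (real l + 1) * 0"
      by (intro tendsto_intros s v)
    then show "(\<lambda>n. real (y n + l + 1) / sqrt (real n)) \<longlonglongrightarrow> u"
      by (simp add: s_def v_def add_divide_distrib add_ac)
    define c where "c = 2 * real l - real k - 1"
    have "(\<lambda>n. ((2 * s n + c * v n)\<^sup>2 - (2 + (real k + 1) * (v n)\<^sup>2)) / (1 + (real k + 2) * (v n)\<^sup>2))
        \<longlonglongrightarrow> ((2 * u + c * 0)\<^sup>2 - (2 + (real k + 1) * 0\<^sup>2)) / (1 + (real k + 2) * 0\<^sup>2)"
      by (intro tendsto_intros s v) auto
    moreover have "eventually (\<lambda>n. ((2 * s n + c * v n)\<^sup>2 - (2 + (real k + 1) * (v n)\<^sup>2)) / (1 + (real k + 2) * (v n)\<^sup>2)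
       = ((2 * real (y n) + 2 * real l - real k - 1)\<^sup>2 - real (2*n+k+1)) / real (n+k+2)) sequentially"
      using eventually_ge_at_top[of 1]
    proof eventually_elim
      case (elim n)
      define r where "r = sqrt (real n)"
      have r: "real n = r * r" "r > 0" using elim by (auto simp: r_def)
      have 1: "(2 * s n + c * v n)\<^sup>2 - (2 + (real k + 1) * (v n)\<^sup>2) = ((2 * real (y n) + c)\<^sup>2 - real (2*n+k+1)) / n"
        unfolding s_def v_def r_def[symmetric] using r
        by (simp add: field_simps power2_eq_square)
      have 2: "1 + (real k + 2) * (v n)\<^sup>2 = real (n+k+2) / n"
        unfolding v_def r_def[symmetric] using r by (simp add: field_simps power2_eq_square)
      have 3: "2 * real (y n) + c = 2 * real (y n) + 2 * real l - real k - 1" by (simp add: c_def)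
      show ?case unfolding 1 2 3 using elim by simp
    qed
    ultimately have "(\<lambda>n. ((2 * real (y n) + 2 * real l - real k - 1)\<^sup>2 - real (2*n+k+1)) / real (n+k+2)) \<longlonglongrightarrow>
       ((2 * u + c * 0)\<^sup>2 - (2 + (real k + 1) * 0\<^sup>2)) / (1 + (real k + 2) * 0\<^sup>2)"
      by (rule Lim_transform_eventually)
    then show "(\<lambda>n. ((2 * real (y n) + 2 * real l - real k - 1)\<^sup>2 - real (2*n+k+1)) / real (n+k+2)) \<longlonglongrightarrow> 4 * u\<^sup>2 - 2"
      by (simp add: power_mult_distrib)
  qed
  then have "(\<lambda>n. tail_term k n (y n)) \<longlonglongrightarrow> (\<Sum>l\<le>k+1. exp (- u\<^sup>2) * (4 * u\<^sup>2 - 2)) / real (k+2)"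
    unfolding tail_term_def by (intro tendsto_divide tendsto_sum tendsto_const) auto
  also have "(\<Sum>l\<le>k+1. exp (- u\<^sup>2) * (4 * u\<^sup>2 - 2)) / real (k+2) = (4 * u\<^sup>2 - 2) * exp (- u\<^sup>2)"
    by (simp add: field_simps)
  finally show ?thesis .
qed

text \<open>
  The polynomial factor of \<open>tail_term\<close> grows linearly in \<open>z = y\<^sup>2 / ((k + 4) n)\<close>, and
  \<open>exp (- z)\<close> and \<open>z exp (- z)\<close> are both at most \<open>2 / z\<close>. Inverse squares suffice for what follows:
  they are summable over \<open>j\<close> and integrable away from zero.
\<close>

lemma tail_term_bound:
  obtains C where "C \<ge> 0"
    "\<And>n y. n \<ge> 1 \<Longrightarrow> y \<ge> 1 \<Longrightarrow> \<bar>tail_term k n y\<bar> \<le> C * real n / (real y)\<^sup>2"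
proof -
  define K where "K = exp ((real k + 2) * (real k + 3) + 1)"
  define A B where "A = (real k + 3)\<^sup>2 * (real k + 4)" and "B = real k + 3"
  define C where "C = K * (2 * A + B) * (real k + 4)"
  have nonneg: "K > 0" "A > 0" "B > 0" by (simp_all add: K_def A_def B_def)
  have "\<bar>tail_term k n y\<bar> \<le> C * real n / (real y)\<^sup>2" if n: "n \<ge> 1" and y: "y \<ge> 1" for n y
  proof -
    define z where "z = (real y)\<^sup>2 / ((real k + 4) * real n)"
    have z: "z > 0" using n y by (auto simp: z_def)
    have e1: "exp (- z) \<le> 1 / z"
    proof -
      have "z \<le> exp z" using exp_ge_add_one_self[of z] by linarith
      then show ?thesis using z by (simp add: exp_minus field_simps)
    qed
    have e2: "exp (- z) * z \<le> 2 / z"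
    proof -
      have "z\<^sup>2 / 2 \<le> exp z" using exp_lower_Taylor_quadratic[of z] z by linarith
      then show ?thesis using z by (simp add: exp_minus field_simps power2_eq_square)
    qed
    have term_bound: "\<bar>binom_ratio k n (y + l + 1) *
        (((2 * real y + 2 * real l - real k - 1)\<^sup>2 - real (2*n+k+1)) / real (n+k+2))\<bar>
        \<le> C * real n / (real y)\<^sup>2" if l: "l \<le> k + 1" for l
    proof -
      have "binom_ratio k n (y + l + 1) \<le> K * exp (- ((real (y + l + 1))\<^sup>2 / ((real k + 4) * real n)))"
        unfolding K_def by (rule binom_ratio_le[OF n])
      also have "\<dots> \<le> K * exp (- z)"
        unfolding z_def using nonneg n
        by (intro mult_left_mono exp_le_cancel_iff[THEN iffD2] le_imp_neg_le divide_right_mono power_mono) auto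
      finally have b: "binom_ratio k n (y + l + 1) \<le> K * exp (- z)" .
      have "\<bar>(2 * real y + 2 * real l - real k - 1)\<^sup>2 - real (2*n+k+1)\<bar>
          \<le> (2 * real y + 2 * real l - real k - 1)\<^sup>2 + real (2*n+k+1)"
        by (rule order_trans[OF abs_triangle_ineq4]) simp
      also have "\<dots> \<le> ((real k + 3) * y)\<^sup>2 + B * n"
      proof (intro add_mono)
        have ky: "real k * 1 \<le> real k * y" using y by (intro mult_left_mono) auto
        have kn: "real k * 1 \<le> real k * n" using n by (intro mult_left_mono) auto
        show "real (2*n+k+1) \<le> B * n" using kn n by (simp add: B_def algebra_simps)
        have "\<bar>2 * real y + 2 * real l - real k - 1\<bar> \<le> (real k + 3) * y"
          using ky y l by (simp add: algebra_simps)
        then have "\<bar>2 * real y + 2 * real l - real k - 1\<bar>\<^sup>2 \<le> ((real k + 3) * y)\<^sup>2"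
          by (intro power_mono) auto
        then show "(2 * real y + 2 * real l - real k - 1)\<^sup>2 \<le> ((real k + 3) * y)\<^sup>2" by simp
      qed
      also have "\<dots> = (A * z + B) * n"
      proof -
        have "z * ((real k + 4) * n) = (real y)\<^sup>2" using n by (simp add: z_def)
        then have "((real k + 3) * y)\<^sup>2 = (real k + 3)\<^sup>2 * (z * ((real k + 4) * n))"
          by (simp add: power_mult_distrib)
        then show ?thesis by (simp add: A_def algebra_simps)
      qed
      finally have "\<bar>(2 * real y + 2 * real l - real k - 1)\<^sup>2 - real (2*n+k+1)\<bar> \<le> (A * z + B) * n" .
      then have "\<bar>((2 * real y + 2 * real l - real k - 1)\<^sup>2 - real (2*n+k+1)) / real (n+k+2)\<bar>
          \<le> (A * z + B) * n / n"
        unfolding abs_divide using n z nonneg by (intro frac_le) auto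
      then have "\<bar>((2 * real y + 2 * real l - real k - 1)\<^sup>2 - real (2*n+k+1)) / real (n+k+2)\<bar> \<le> A * z + B"
        using n by simp
      with b have "\<bar>binom_ratio k n (y + l + 1) *
          (((2 * real y + 2 * real l - real k - 1)\<^sup>2 - real (2*n+k+1)) / real (n+k+2))\<bar>
          \<le> (K * exp (- z)) * (A * z + B)"
        unfolding abs_mult using nonneg by (intro mult_mono) (auto simp: binom_ratio_nonneg)
      also have "\<dots> = K * (A * (exp (- z) * z) + B * exp (- z))" by (simp add: algebra_simps)
      also have "\<dots> \<le> K * (A * (2 / z) + B * (1 / z))"
        using nonneg e1 e2 by (intro mult_left_mono add_mono) auto
      also have "\<dots> = C * real n / (real y)\<^sup>2"
        using n y by (simp add: C_def z_def field_simps)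
      finally show ?thesis .
    qed
    have "\<bar>tail_term k n y\<bar> \<le> (\<Sum>l\<le>k+1. C * real n / (real y)\<^sup>2) / real (k+2)"
      unfolding tail_term_def abs_divide abs_of_nat
      by (intro divide_right_mono order_trans[OF sum_abs] sum_mono term_bound) auto
    also have "(\<Sum>l\<le>k+1. c) / real (k+2) = c" for c :: real by (simp add: field_simps)
    finally show ?thesis .
  qed
  moreover have "C \<ge> 0" using nonneg by (simp add: C_def)
  ultimately show ?thesis using that by blast
qed

section \<open>Summation over the levels\<close>

text \<open>
  Rounding up turns the sum over levels into an integral over the rescaled level \<open>t = H / r\<close>, to which
  dominated convergence applies.
\<close>

lemma has_integral_step_function:
  fixes g :: "nat \<Rightarrow> real" and r :: real
  assumes "r > 0"
  shows "has_bochner_integral lborel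
           (\<lambda>t. indicator {real N / r<..real U / r} t * g (nat \<lceil>t * r\<rceil>))
           ((\<Sum>H\<in>{N<..U}. g H) / r)"
proof -
  define cell where "cell H = {(real H - 1) / r<..real H / r}" for H :: nat
  have "has_bochner_integral lborel (\<lambda>t. \<Sum>H\<in>{N<..U}. g H * indicator (cell H) t)
      (\<Sum>H\<in>{N<..U}. g H * (1 / r))"
  proof (intro has_bochner_integral_sum has_bochner_integral_mult_right)
    fix H
    have le: "(real H - 1) / r \<le> real H / r" using assms by (intro divide_right_mono) auto
    have "has_bochner_integral lborel (indicator (cell H)) (measure lborel (cell H))"
      using le unfolding cell_def by (intro has_bochner_integral_real_indicator) auto
    also have "measure lborel (cell H) = 1 / r"
      unfolding cell_def using le assms by (simp add: diff_divide_distrib)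
    finally show "has_bochner_integral lborel (indicator (cell H)) (1 / r)" .
  qed
  also have "(\<lambda>t. \<Sum>H\<in>{N<..U}. g H * indicator (cell H) t) =
      (\<lambda>t. indicator {real N / r<..real U / r} t * g (nat \<lceil>t * r\<rceil>))"
  proof
    fix t
    have cell: "t \<in> cell H \<longleftrightarrow> real H - 1 < t * r \<and> t * r \<le> real H" for H
      using assms by (simp add: cell_def field_simps)
    show "(\<Sum>H\<in>{N<..U}. g H * indicator (cell H) t) =
        indicator {real N / r<..real U / r} t * g (nat \<lceil>t * r\<rceil>)"
    proof (cases "real N < t * r \<and> t * r \<le> real U")
      case True
      define c where "c = nat \<lceil>t * r\<rceil>"
      have "\<lceil>t * r\<rceil> > int N" using True by (simp add: less_ceiling_iff)
      moreover have "\<lceil>t * r\<rceil> \<le> int U" using True by (simp add: ceiling_le_iff)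
      ultimately have "N < c" "c \<le> U" and c_eq: "\<lceil>t * r\<rceil> = int c"
        unfolding c_def by linarith+
      then have c: "c \<in> {N<..U}" by simp
      have iff: "t \<in> cell H \<longleftrightarrow> H = c" for H
        unfolding cell using c_eq by (metis ceiling_eq_iff of_int_of_nat_eq of_nat_eq_iff)
      have "(\<Sum>H\<in>{N<..U}. g H * indicator (cell H) t) = (\<Sum>H\<in>{N<..U}. if H = c then g H else 0)"
        by (intro sum.cong refl) (auto simp: iff indicator_def)
      also have "\<dots> = g c" using c by simp
      also have "\<dots> = indicator {real N / r<..real U / r} t * g c"
        using True assms by (simp add: field_simps)
      finally show ?thesis by (simp add: c_def)
    next
      case False
      have "t \<notin> cell H" if "H \<in> {N<..U}" for H
        using False that unfolding cell by auto
      then have "(\<Sum>H\<in>{N<..U}. g H * indicator (cell H) t) = 0"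
        by (intro sum.neutral) auto
      moreover have "t \<notin> {real N / r<..real U / r}" using False assms by (auto simp: field_simps)
      ultimately show ?thesis by simp
    qed
  qed
  finally show ?thesis by (simp add: sum_distrib_right[symmetric] sum_divide_distrib)
qed

lemma has_integral_inverse_square_tail:
  fixes a c :: real
  assumes "a > 0" "c \<ge> 0"
  shows "has_bochner_integral lborel (\<lambda>t. indicator {a..} t * (c / t\<^sup>2)) (c / a)"
proof (rule has_bochner_integral_nn_integral)
  have "(\<integral>\<^sup>+t. ennreal (c / t\<^sup>2) * indicator {a..} t \<partial>lborel) = ennreal (0 - (- c / a))"
  proof (rule nn_integral_FTC_atLeast)
    show "((\<lambda>t. - c / t) has_real_derivative c / x\<^sup>2) (at x)" if "a \<le> x" for x
      using assms that by (auto intro!: derivative_eq_intros simp: power2_eq_square)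
    show "((\<lambda>t. - c / t) \<longlongrightarrow> 0) at_top" by real_asymp
  qed (use assms in auto)
  moreover have "ennreal (indicator {a..} t * (c / t\<^sup>2)) = ennreal (c / t\<^sup>2) * indicator {a..} t" for t
    by (simp split: split_indicator)
  ultimately show "(\<integral>\<^sup>+t. ennreal (indicator {a..} t * (c / t\<^sup>2)) \<partial>lborel) = ennreal (c / a)" by simp
qed (use assms in auto)

lemma rounded_up_tendsto:
  "(\<lambda>n. real (nat \<lceil>t * sqrt (real n)\<rceil>) / sqrt (real n)) \<longlonglongrightarrow> t" if "t > 0" for t :: real
proof (rule tendsto_sandwich)
  have *: "t * sqrt (real n) \<le> real (nat \<lceil>t * sqrt (real n)\<rceil>) \<and>
      real (nat \<lceil>t * sqrt (real n)\<rceil>) \<le> t * sqrt (real n) + 1" for n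
  proof -
    have "t * sqrt (real n) \<ge> 0" using that by simp
    then show ?thesis by linarith
  qed
  show "eventually (\<lambda>n. t \<le> real (nat \<lceil>t * sqrt (real n)\<rceil>) / sqrt (real n)) sequentially"
    using eventually_gt_at_top[of 0] by eventually_elim (use * in \<open>auto simp: field_simps\<close>)
  show "eventually (\<lambda>n. real (nat \<lceil>t * sqrt (real n)\<rceil>) / sqrt (real n) \<le> t + 1 / sqrt (real n)) sequentially"
    using eventually_gt_at_top[of 0] by eventually_elim (use * in \<open>auto simp: field_simps\<close>)
  show "(\<lambda>_. t) \<longlonglongrightarrow> t" by simp
  show "(\<lambda>n. t + 1 / sqrt (real n)) \<longlonglongrightarrow> t"
    using tendsto_add[OF tendsto_const[of t] inverse_sqrt_tendsto_0] by simp
qed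

text \<open>
  The part of the average height that is due to the \<open>j\<close>-th reflections and to levels above
  \<open>\<epsilon> sqrt n\<close>. The upper end is the largest level \<open>H = h + 3\<close> with \<open>h < n + k\<close>, which
  bounds the height.
\<close>

definition scaled_tail :: "nat \<Rightarrow> real \<Rightarrow> nat \<Rightarrow> nat \<Rightarrow> real" where
  "scaled_tail k \<epsilon> j n =
     (\<Sum>H\<in>{nat \<lceil>\<epsilon> * sqrt n\<rceil><..n+k+2}. tail_term k n (j * H)) / sqrt n"

text \<open>
  The integrand is dominated by a multiple of \<open>1 / (j t)\<^sup>2\<close> for \<open>t \<ge> \<epsilon>\<close>, which yields both
  the bound and the convergence; the limit integral is evaluated by the antiderivative
  \<open>- 2 t exp (- (j t)\<^sup>2)\<close>, of which only the boundary term at \<open>\<epsilon>\<close> remains.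
\<close>

lemma scaled_tail:
  assumes "\<epsilon> > 0"
  obtains C where
    "\<And>j n. j \<ge> 1 \<Longrightarrow> \<bar>scaled_tail k \<epsilon> j n\<bar> \<le> C / (real j)\<^sup>2"
    "\<And>j. j \<ge> 1 \<Longrightarrow> scaled_tail k \<epsilon> j \<longlonglongrightarrow> 2 * \<epsilon> * exp (- (real j * \<epsilon>)\<^sup>2)"
proof -
  obtain C where C: "C \<ge> 0"
    "\<And>n y. n \<ge> 1 \<Longrightarrow> y \<ge> 1 \<Longrightarrow> \<bar>tail_term k n y\<bar> \<le> C * real n / (real y)\<^sup>2"
    using tail_term_bound[of k] by blast
  define N where "N n = nat \<lceil>\<epsilon> * sqrt (real n)\<rceil>" for n :: nat
  define I where "I n = {real (N n) / sqrt (real n)<..real (n+k+2) / sqrt (real n)}" for n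
  define s where "s j n t = indicator (I n) t
     * tail_term k n (j * nat \<lceil>t * sqrt (real n)\<rceil>)" for j n :: nat and t :: real
  define w where "w j t = indicator {\<epsilon>..} t * ((C / (real j)\<^sup>2) / t\<^sup>2)" for j :: nat and t :: real
  define f where "f j t = (4 * (real j * t)\<^sup>2 - 2) * exp (- (real j * t)\<^sup>2)" for j :: nat and t :: real
  have N: "\<epsilon> \<le> real (N n) / sqrt (real n)" if "n \<ge> 1" for n
  proof -
    have "\<epsilon> * sqrt (real n) \<le> real (N n)" unfolding N_def by linarith
    then show ?thesis using that by (simp add: field_simps)
  qed
  have s_int: "has_bochner_integral lborel (s j n) (scaled_tail k \<epsilon> j n)" for j n
  proof (cases "n = 0")
    case True
    then have "s j n = (\<lambda>_. 0)" by (auto simp: s_def I_def fun_eq_iff)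
    then show ?thesis using True by (simp add: scaled_tail_def has_bochner_integral_zero)
  next
    case False
    then show ?thesis
      unfolding s_def I_def scaled_tail_def N_def by (intro has_integral_step_function) simp
  qed
  have w_int: "has_bochner_integral lborel (w j) (C / (real j)\<^sup>2 / \<epsilon>)" for j
    unfolding w_def using assms C(1) by (intro has_integral_inverse_square_tail) auto
  have s_le: "\<bar>s j n t\<bar> \<le> w j t" if j: "j \<ge> 1" for j n t
  proof (cases "n \<ge> 1 \<and> t \<in> I n")
    case False
    have "s j n t = 0"
    proof (cases "n = 0")
      case False
      then have "t \<notin> I n"
        using \<open>\<not> (n \<ge> 1 \<and> _)\<close> by simp
      then show ?thesis by (simp add: s_def)
    qed (simp add: s_def I_def)
    moreover have "w j t \<ge> 0" using C(1) by (simp add: w_def)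
    ultimately show ?thesis by simp
  next
    case True
    then have t: "t > \<epsilon>" "n \<ge> 1" using N[of n] by (auto simp: I_def)
    define H where "H = nat \<lceil>t * sqrt (real n)\<rceil>"
    have pos: "t * sqrt (real n) > 0" using t assms by simp
    have H: "real H \<ge> t * sqrt (real n)" unfolding H_def by linarith
    then have "real H > 0" using pos by linarith
    then have "H \<ge> 1" by simp
    have "\<bar>s j n t\<bar> = \<bar>tail_term k n (j * H)\<bar>" using True by (simp add: s_def H_def)
    also have "\<dots> \<le> C * real n / (real (j * H))\<^sup>2"
      using j \<open>H \<ge> 1\<close> by (intro C(2) t(2)) simp
    also have "\<dots> \<le> C * real n / (real j * (t * sqrt (real n)))\<^sup>2"
      using C(1) j pos H t \<open>real H > 0\<close> by (intro divide_left_mono power_mono mult_pos_pos) (auto intro!: mult_left_mono)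
    also have "\<dots> = w j t"
      using t by (simp add: w_def power_mult_distrib)
    finally show ?thesis .
  qed
  have pointwise: "(\<lambda>n. s j n t) \<longlonglongrightarrow> indicator {\<epsilon><..} t * f j t" for j t
  proof (cases "t > \<epsilon>")
    case False
    have ev: "eventually (\<lambda>n. 0 = s j n t) sequentially"
      using eventually_ge_at_top[of 1]
    proof eventually_elim
      case (elim n)
      have "t \<notin> I n" using N[of n] elim False by (auto simp: I_def)
      then show ?case by (simp add: s_def)
    qed
    from Lim_transform_eventually[OF tendsto_const ev] False show ?thesis by simp
  next
    case True
    then have "t > 0" using assms by simp
    have "eventually (\<lambda>n. real (N n) / sqrt (real n) < t) sequentially"
      using order_tendstoD(2)[OF rounded_up_tendsto[OF assms] True] by (simp add: N_def)
    moreover have "filterlim (\<lambda>n. real (n+k+2) / sqrt (real n)) at_top sequentially" by real_asymp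
    then have "eventually (\<lambda>n. real (n+k+2) / sqrt (real n) \<ge> t) sequentially"
      by (simp add: filterlim_at_top)
    ultimately have ev: "eventually (\<lambda>n. tail_term k n (j * nat \<lceil>t * sqrt (real n)\<rceil>) = s j n t) sequentially"
      by eventually_elim (simp add: s_def I_def)
    have "(\<lambda>n. real j * (real (nat \<lceil>t * sqrt (real n)\<rceil>) / sqrt (real n))) \<longlonglongrightarrow> real j * t"
      by (intro tendsto_intros rounded_up_tendsto \<open>t > 0\<close>)
    then have "(\<lambda>n. tail_term k n (j * nat \<lceil>t * sqrt (real n)\<rceil>)) \<longlonglongrightarrow> f j t"
      unfolding f_def by (intro tail_term_tendsto) simp
    from Lim_transform_eventually[OF this ev] True show ?thesis by simp
  qed
  have dom: "integrable lborel (\<lambda>t. indicator {\<epsilon><..} t * f j t)"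
    "(\<lambda>n. integral\<^sup>L lborel (s j n)) \<longlonglongrightarrow> integral\<^sup>L lborel (\<lambda>t. indicator {\<epsilon><..} t * f j t)"
    if j: "j \<ge> 1" for j
  proof -
    have m: "(\<lambda>t. indicator {\<epsilon><..} t * f j t) \<in> borel_measurable lborel"
      unfolding f_def by measurable
    note prem = m borel_measurable_has_bochner_integral[OF s_int] integrable.intros[OF w_int]
      AE_I2[OF pointwise] AE_I2[OF s_le[OF j, folded real_norm_def]]
    show "integrable lborel (\<lambda>t. indicator {\<epsilon><..} t * f j t)"
      by (rule integrable_dominated_convergence[OF prem])
    show "(\<lambda>n. integral\<^sup>L lborel (s j n)) \<longlonglongrightarrow> integral\<^sup>L lborel (\<lambda>t. indicator {\<epsilon><..} t * f j t)"
      by (rule integral_dominated_convergence[OF prem])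
  qed
  have f_int: "integral\<^sup>L lborel (\<lambda>t. indicator {\<epsilon><..} t * f j t) = 2 * \<epsilon> * exp (- (real j * \<epsilon>)\<^sup>2)"
    if j: "j \<ge> 1" for j
  proof -
    \<comment> \<open>an antiderivative of \<open>f j\<close>\<close>
    define F where "F t = - 2 * t * exp (- (real j * t)\<^sup>2)" for t :: real
    have "(LBINT t=ereal \<epsilon>..\<infinity>. f j t) = 0 - F \<epsilon>"
    proof (rule interval_integral_FTC_integrable)
      show "(F has_vector_derivative f j x) (at x)" for x
        unfolding F_def f_def has_real_derivative_iff_has_vector_derivative[symmetric]
        by (auto intro!: derivative_eq_intros simp: power2_eq_square algebra_simps)
      show "isCont (f j) x" for x unfolding f_def by (intro continuous_intros)
      have "einterval (ereal \<epsilon>) \<infinity> = {\<epsilon><..}" by (auto simp: einterval_def)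
      then show "set_integrable lborel (einterval (ereal \<epsilon>) \<infinity>) (f j)"
        using dom(1)[OF j] by (simp add: set_integrable_def)
      have "isCont F \<epsilon>" unfolding F_def by (intro continuous_intros)
      then have "(F \<longlongrightarrow> F \<epsilon>) (at_right \<epsilon>)"
        using continuous_at_imp_continuous_at_within continuous_within by blast
      then show "((F \<circ> real_of_ereal) \<longlongrightarrow> F \<epsilon>) (at_right (ereal \<epsilon>))"
        by (simp add: ereal_tendsto_simps)
      have "real j > 0" using j by simp
      then have "(F \<longlongrightarrow> 0) at_top" unfolding F_def by real_asymp
      then show "((F \<circ> real_of_ereal) \<longlongrightarrow> 0) (at_left \<infinity>)"
        by (simp add: ereal_tendsto_simps)
    qed simp
    then show ?thesis
      by (simp add: interval_integral_to_infinity_eq set_lebesgue_integral_def F_def)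
  qed
  have "\<bar>scaled_tail k \<epsilon> j n\<bar> \<le> (C / \<epsilon>) / (real j)\<^sup>2" if j: "j \<ge> 1" for j n
  proof -
    have "norm (integral\<^sup>L lborel (s j n)) \<le> integral\<^sup>L lborel (w j)"
      using s_le[OF j] by (intro Bochner_Integration.integral_norm_bound_integral
          integrable.intros[OF s_int] integrable.intros[OF w_int]) auto
    then show ?thesis
      using has_bochner_integral_integral_eq[OF s_int, of j n] has_bochner_integral_integral_eq[OF w_int, of j]
      by (simp add: mult.commute)
  qed
  moreover have "scaled_tail k \<epsilon> j \<longlonglongrightarrow> 2 * \<epsilon> * exp (- (real j * \<epsilon>)\<^sup>2)" if "j \<ge> 1" for j
    using dom(2)[OF that] f_int[OF that] has_bochner_integral_integral_eq[OF s_int] by simp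
  ultimately show ?thesis using that by blast
qed

lemma sum_scaled_tail_tendsto:
  assumes "\<epsilon> > 0"
  defines "\<theta> \<equiv> (\<lambda>j. 2 * \<epsilon> * exp (- (real (Suc j) * \<epsilon>)\<^sup>2))"
  shows "(\<lambda>n. \<Sum>j=1..n. scaled_tail k \<epsilon> j n) \<longlonglongrightarrow> suminf \<theta>" and "summable \<theta>"
proof -
  obtain C where C:
    "\<And>j n. j \<ge> 1 \<Longrightarrow> \<bar>scaled_tail k \<epsilon> j n\<bar> \<le> C / (real j)\<^sup>2"
    "\<And>j. j \<ge> 1 \<Longrightarrow> scaled_tail k \<epsilon> j \<longlonglongrightarrow> 2 * \<epsilon> * exp (- (real j * \<epsilon>)\<^sup>2)"
    using scaled_tail[OF assms(1), of k] by blast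
  have "C \<ge> 0" using C(1)[of 1 0] by simp
  define a where "a j n = (if j < n then scaled_tail k \<epsilon> (Suc j) n else 0)" for j n
  have "summable (\<lambda>j. C * (1 / (real (Suc j))\<^sup>2))"
    using inverse_power_summable[of 2, where 'a=real]
    by (intro summable_mult) (subst summable_Suc_iff, simp add: divide_inverse)
  then have M: "summable (\<lambda>j. C / (real (Suc j))\<^sup>2)" by simp
  have "eventually (\<lambda>n. summable (\<lambda>j. norm (a j n))) sequentially \<and> summable (\<lambda>j. norm (\<theta> j)) \<and>
    (\<lambda>n. suminf (\<lambda>j. a j n)) \<longlonglongrightarrow> suminf \<theta>"
  proof (rule tannerys_theorem)
    show "(\<lambda>n. a j n) \<longlonglongrightarrow> \<theta> j" for j
    proof (rule Lim_transform_eventually)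
      show "scaled_tail k \<epsilon> (Suc j) \<longlonglongrightarrow> \<theta> j" unfolding \<theta>_def by (rule C(2)) simp
      show "eventually (\<lambda>n. scaled_tail k \<epsilon> (Suc j) n = a j n) sequentially"
        using eventually_gt_at_top[of j] by eventually_elim (simp add: a_def)
    qed
    have "norm (a j n) \<le> C / (real (Suc j))\<^sup>2" for j n
      using C(1)[of "Suc j" n] \<open>C \<ge> 0\<close> by (simp add: a_def)
    then show "eventually (\<lambda>(j, n). norm (a j n) \<le> C / (real (Suc j))\<^sup>2) (at_top \<times>\<^sub>F sequentially)"
      by (intro always_eventually) auto
  qed (use M in auto)
  moreover have "suminf (\<lambda>j. a j n) = (\<Sum>j=1..n. scaled_tail k \<epsilon> j n)" for n
  proof -
    have "suminf (\<lambda>j. a j n) = (\<Sum>j<n. a j n)"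
      by (rule suminf_finite) (auto simp: a_def)
    also have "\<dots> = (\<Sum>j<n. scaled_tail k \<epsilon> (Suc j) n)" by (simp add: a_def)
    also have "\<dots> = (\<Sum>j=1..n. scaled_tail k \<epsilon> j n)"
      by (simp add: sum.atLeast1_atMost_eq)
    finally show ?thesis .
  qed
  ultimately show "(\<lambda>n. \<Sum>j=1..n. scaled_tail k \<epsilon> j n) \<longlonglongrightarrow> suminf \<theta>" "summable \<theta>"
    by (auto intro: summable_norm_cancel)
qed

text \<open>
  The function is decreasing, so its Riemann sum with mesh \<open>\<epsilon>\<close> that omits the value at \<open>0\<close> lies
  below the integral, by at most \<open>\<epsilon>\<close> times that value.
\<close>

lemma gaussian_riemann_sum:
  assumes "\<epsilon> > 0"
  defines "\<theta> \<equiv> (\<lambda>j. 2 * \<epsilon> * exp (- (real (Suc j) * \<epsilon>)\<^sup>2))"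
  shows "sqrt pi - 2 * \<epsilon> \<le> suminf \<theta>" "suminf \<theta> \<le> sqrt pi"
proof -
  define f where "f x = exp (- (x * \<epsilon>)\<^sup>2)" for x :: real
  interpret antimono_fun_sum_integral_diff f
  proof
    show "f y \<le> f x" if "0 \<le> x" "x \<le> y" for x y
    proof -
      have "(x * \<epsilon>)\<^sup>2 \<le> (y * \<epsilon>)\<^sup>2"
        using that assms by (intro power_mono mult_right_mono) auto
      then show ?thesis by (simp add: f_def)
    qed
    show "continuous_on {0..} f" unfolding f_def by (intro continuous_intros)
  qed (simp add: f_def)
  define g where "g t = indicator {0..} t * f t" for t :: real
  have "has_bochner_integral lborel (\<lambda>x. indicator {0..} (0 + \<epsilon> * x) *\<^sub>R exp (- (0 + \<epsilon> * x)\<^sup>2)) ((sqrt pi / 2) /\<^sub>R \<bar>\<epsilon>\<bar>)"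
    using assms by (intro lborel_has_bochner_integral_real_affine_iff[THEN iffD1, OF _ gaussian_moment_0]) simp
  moreover have "indicator {0..} (0 + \<epsilon> * x) *\<^sub>R exp (- (0 + \<epsilon> * x)\<^sup>2) = g x" for x
    using assms(1) by (simp add: g_def f_def indicator_def zero_le_mult_iff mult.commute)
  moreover have "(sqrt pi / 2) /\<^sub>R \<bar>\<epsilon>\<bar> = sqrt pi / (2 * \<epsilon>)"
    using assms(1) by (simp add: field_simps)
  ultimately have "has_bochner_integral lborel g (sqrt pi / (2 * \<epsilon>))"
    by (simp only:)
  then have g: "integrable lborel g" "integral\<^sup>L lborel g = sqrt pi / (2 * \<epsilon>)"
    by (auto simp: has_bochner_integral_iff)
  have "((\<lambda>y. LINT t|lborel. indicator {..y} t *\<^sub>R g t) \<longlongrightarrow> sqrt pi / (2 * \<epsilon>)) at_top"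
    using tendsto_integral_at_top[OF _ g(1)] g(2) by simp
  moreover have "(LINT t|lborel. indicator {..y} t *\<^sub>R g t) = integral {0..y} f" for y
  proof -
    have "set_integrable lborel {0..y} f"
      unfolding f_def by (intro borel_integrable_atLeastAtMost' continuous_intros)
    then have "integral {0..y} f = (LINT t:{0..y}|lborel. f t)"
      by (rule set_borel_integral_eq_integral(2)[symmetric])
    also have "\<dots> = (LINT t|lborel. indicator {..y} t *\<^sub>R g t)"
      unfolding set_lebesgue_integral_def g_def
      by (intro Bochner_Integration.integral_cong refl) (auto simp: indicator_def)
    finally show ?thesis by simp
  qed
  ultimately have "((\<lambda>y. integral {0..y} f) \<longlongrightarrow> sqrt pi / (2 * \<epsilon>)) at_top" by simp
  then have int: "(\<lambda>n. integral {0..real n} f) \<longlonglongrightarrow> sqrt pi / (2 * \<epsilon>)"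
    by (rule filterlim_compose) (rule filterlim_real_sequentially)
  have f\<theta>: "f (real (Suc j)) = \<theta> j / (2 * \<epsilon>)" for j using assms by (simp add: f_def \<theta>_def)
  have "summable (\<lambda>j. f (real (Suc j)))"
    unfolding f\<theta> using sum_scaled_tail_tendsto(2)[OF assms(1)] unfolding \<theta>_def by (intro summable_divide)
  then have "summable (\<lambda>j. f (real j))" by (simp add: summable_Suc_iff[of "\<lambda>j. f (real j)", symmetric])
  have "suminf (\<lambda>j. f (real (Suc j))) = suminf \<theta> / (2 * \<epsilon>)"
    unfolding f\<theta> using sum_scaled_tail_tendsto(2)[OF assms(1)] unfolding \<theta>_def by (rule suminf_divide)
  then have total: "suminf (\<lambda>j. f (real j)) = 1 + suminf \<theta> / (2 * \<epsilon>)"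
    using suminf_split_head[OF \<open>summable (\<lambda>j. f (real j))\<close>] by (simp add: f_def)
  have "(\<lambda>n. \<Sum>j\<le>n. f (real j)) \<longlonglongrightarrow> suminf (\<lambda>j. f (real j))"
    by (rule summable_LIMSEQ') fact
  then have lim: "sum_integral_diff_series \<longlonglongrightarrow> 1 + suminf \<theta> / (2 * \<epsilon>) - sqrt pi / (2 * \<epsilon>)"
    unfolding sum_integral_diff_series_def total by (intro tendsto_diff int)
  have "sum_integral_diff_series n \<le> 1" for n
    using sum_integral_diff_series_antimono[of 0 n] by (simp add: sum_integral_diff_series_def f_def)
  then have "1 + suminf \<theta> / (2 * \<epsilon>) - sqrt pi / (2 * \<epsilon>) \<le> 1"
    using lim by (intro LIMSEQ_le_const2[OF lim]) auto
  moreover have "0 \<le> 1 + suminf \<theta> / (2 * \<epsilon>) - sqrt pi / (2 * \<epsilon>)"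
    by (intro LIMSEQ_le_const[OF lim]) (auto intro: sum_integral_diff_series_nonneg)
  ultimately have "- 1 \<le> (suminf \<theta> - sqrt pi) / (2 * \<epsilon>)" "(suminf \<theta> - sqrt pi) / (2 * \<epsilon>) \<le> 0"
    by (simp_all add: diff_divide_distrib)
  then show "sqrt pi - 2 * \<epsilon> \<le> suminf \<theta>" "suminf \<theta> \<le> sqrt pi"
    using assms(1) by (simp_all add: pos_le_divide_eq pos_divide_le_eq)
qed

section \<open>The average height\<close>

lemma average_height_eq_tail_sum:
  assumes "n \<ge> 1"
  shows "average_height n k =
    (\<Sum>h<n+k. 1 - real (card (low_paths h n k)) / real (card (lukasiewicz_paths n k)))"
proof -
  define S where "S = lukasiewicz_paths n k"
  have fin: "finite S" and "S \<noteq> {}"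
    unfolding S_def using finite_lukasiewicz_paths lukasiewicz_paths_nonempty[OF assms] by auto
  then have pos: "real (card S) > 0" by (simp add: card_gt_0_iff)
  have height: "real_of_int (path_height p) = (\<Sum>h<n+k. if path_height p \<le> int h then 0 else 1)"
    if "p \<in> S" for p
  proof -
    have "ordinate p 0 \<le> path_height p"
      using path_height_le_iff[of p "path_height p"] by blast
    then have "path_height p \<ge> 0" by (simp add: ordinate_def)
    then obtain a where a: "path_height p = int a" using nonneg_int_cases by blast
    then have "a \<le> n + k" using path_height_le[of p n k] that by (simp add: S_def)
    have "(\<Sum>h<n+k. if path_height p \<le> int h then 0 else 1) = (\<Sum>h\<in>{..<a}. 1::real)"
      using \<open>a \<le> n + k\<close> by (intro sum.mono_neutral_cong_right) (auto simp: a)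
    then show ?thesis by (simp add: a)
  qed
  have "(\<Sum>p\<in>S. real_of_int (path_height p)) = (\<Sum>p\<in>S. \<Sum>h<n+k. if path_height p \<le> int h then 0 else 1)"
    by (intro sum.cong refl height)
  also have "\<dots> = (\<Sum>h<n+k. \<Sum>p\<in>S. if path_height p \<le> int h then 0 else 1)"
    by (rule sum.swap)
  also have "\<dots> = (\<Sum>h<n+k. real (card S) - real (card (low_paths h n k)))"
  proof (intro sum.cong refl)
    fix h
    have sub: "low_paths h n k \<subseteq> S" by (auto simp: low_paths_def S_def)
    have "(\<Sum>p\<in>S. if path_height p \<le> int h then 0 else 1) = (\<Sum>p\<in>S - low_paths h n k. 1::real)"
      using fin by (intro sum.mono_neutral_cong_right) (auto simp: low_paths_def S_def)
    also have "\<dots> = real (card S) - real (card (low_paths h n k))"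
      using fin sub by (simp add: card_Diff_subset finite_subset of_nat_diff card_mono)
    finally show "(\<Sum>p\<in>S. if path_height p \<le> int h then 0 else 1) = real (card S) - real (card (low_paths h n k))" .
  qed
  finally have "average_height n k = (\<Sum>h<n+k. real (card S) - real (card (low_paths h n k))) / real (card S)"
    unfolding average_height_def S_def by simp
  also have "\<dots> = (\<Sum>h<n+k. 1 - real (card (low_paths h n k)) / real (card S))"
    unfolding sum_divide_distrib using pos by (intro sum.cong refl) (simp add: diff_divide_distrib)
  finally show ?thesis by (simp add: S_def)
qed

text \<open>
  Levels up to \<open>\<epsilon> sqrt n\<close> are estimated trivially. The hypothesis on \<open>n\<close> places the
  levels \<open>h < k\<close> among them, for which the counting formula is not available.
\<close>

lemma average_height_bounds:
  assumes "n \<ge> 1" "\<epsilon> * sqrt n \<ge> real k + 3"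
  shows "(\<Sum>j=1..n. scaled_tail k \<epsilon> j n) \<le> average_height n k / sqrt n"
    and "average_height n k / sqrt n \<le>
      (\<Sum>j=1..n. scaled_tail k \<epsilon> j n) + real (nat \<lceil>\<epsilon> * sqrt n\<rceil>) / sqrt n"
proof -
  define N where "N = nat \<lceil>\<epsilon> * sqrt (real n)\<rceil>"
  define q where "q h = 1 - real (card (low_paths h n k)) / real (card (lukasiewicz_paths n k))" for h
  have "real N \<ge> real (k + 3)" using assms(2) unfolding N_def by linarith
  then have N: "N \<ge> k + 3" by linarith
  have "lukasiewicz_paths n k \<noteq> {}" using lukasiewicz_paths_nonempty[OF assms(1)] .
  then have "card (lukasiewicz_paths n k) > 0" using finite_lukasiewicz_paths by (simp add: card_gt_0_iff)
  moreover have "card (low_paths h n k) \<le> card (lukasiewicz_paths n k)" for h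
    by (intro card_mono finite_lukasiewicz_paths) (auto simp: low_paths_def)
  ultimately have q: "0 \<le> q h" "q h \<le> 1" for h by (auto simp: q_def)
  have "average_height n k = (\<Sum>h<n+k. q h)"
    unfolding q_def by (rule average_height_eq_tail_sum[OF assms(1)])
  also have "\<dots> = (\<Sum>h\<in>{h. h < n + k \<and> h + 3 \<le> N}. q h) + (\<Sum>h\<in>{h. h < n + k \<and> N < h + 3}. q h)"
    by (subst sum.union_disjoint[symmetric]) (auto intro!: sum.cong)
  also have "(\<Sum>h\<in>{h. h < n + k \<and> N < h + 3}. q h) =
      (\<Sum>H\<in>{N<..n+k+2}. \<Sum>j=1..n. tail_term k n (j * H))"
  proof (rule sum.reindex_bij_witness[of _ "\<lambda>H. H - 3" "\<lambda>h. h + 3"])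
    fix h assume "h \<in> {h. h < n + k \<and> N < h + 3}"
    then have "k \<le> h" using N by simp
    then show "(\<Sum>j=1..n. tail_term k n (j * (h + 3))) = q h"
      unfolding q_def by (rule proportion_of_high_paths[OF assms(1), symmetric])
  qed (use N in auto)
  also have "\<dots> = (\<Sum>j=1..n. scaled_tail k \<epsilon> j n) * sqrt n"
    using assms(1) unfolding scaled_tail_def N_def[symmetric]
    by (subst sum.swap) (simp add: sum_divide_distrib[symmetric])
  finally have E: "average_height n k / sqrt n =
      (\<Sum>h\<in>{h. h < n + k \<and> h + 3 \<le> N}. q h) / sqrt n + (\<Sum>j=1..n. scaled_tail k \<epsilon> j n)"
    using assms(1) by (simp add: add_divide_distrib)
  have "(\<Sum>h\<in>{h. h < n + k \<and> h + 3 \<le> N}. q h) \<le> real (card {h. h < n + k \<and> h + 3 \<le> N}) * 1"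
    using q by (intro sum_bounded_above) auto
  also have "card {h. h < n + k \<and> h + 3 \<le> N} \<le> card {..<N}"
    by (intro card_mono) auto
  finally have "(\<Sum>h\<in>{h. h < n + k \<and> h + 3 \<le> N}. q h) \<le> real N" by simp
  then have "(\<Sum>h\<in>{h. h < n + k \<and> h + 3 \<le> N}. q h) / sqrt n \<le> real N / sqrt n"
    by (intro divide_right_mono) auto
  then show "average_height n k / sqrt n \<le>
      (\<Sum>j=1..n. scaled_tail k \<epsilon> j n) + real (nat \<lceil>\<epsilon> * sqrt n\<rceil>) / sqrt n"
    unfolding E N_def by simp
  have "0 \<le> (\<Sum>h\<in>{h. h < n + k \<and> h + 3 \<le> N}. q h) / sqrt n"
    using q by (intro divide_nonneg_nonneg sum_nonneg) auto
  then show "(\<Sum>j=1..n. scaled_tail k \<epsilon> j n) \<le> average_height n k / sqrt n"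
    unfolding E by simp
qed

lemma average_height_tendsto: "(\<lambda>n. average_height n k / sqrt n) \<longlonglongrightarrow> sqrt pi"
proof (rule LIMSEQ_I)
  fix \<delta> :: real assume "\<delta> > 0"
  \<comment> \<open>The error is at most \<open>2 \<epsilon>\<close> below and \<open>\<epsilon>\<close> above, up to \<open>o(1)\<close>.\<close>
  define \<epsilon> where "\<epsilon> = \<delta> / 3"
  have \<epsilon>: "\<epsilon> > 0" using \<open>\<delta> > 0\<close> by (simp add: \<epsilon>_def)
  define L where "L = (\<Sum>j. 2 * \<epsilon> * exp (- (real (Suc j) * \<epsilon>)\<^sup>2))"
  have L: "sqrt pi - 2 * \<epsilon> \<le> L" "L \<le> sqrt pi"
    unfolding L_def using gaussian_riemann_sum[OF \<epsilon>] by simp_all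
  have lim: "(\<lambda>n. \<Sum>j=1..n. scaled_tail k \<epsilon> j n) \<longlonglongrightarrow> L"
    unfolding L_def by (rule sum_scaled_tail_tendsto(1)[OF \<epsilon>])
  have lim': "(\<lambda>n. (\<Sum>j=1..n. scaled_tail k \<epsilon> j n) + real (nat \<lceil>\<epsilon> * sqrt n\<rceil>) / sqrt n) \<longlonglongrightarrow> L + \<epsilon>"
    by (intro tendsto_add lim rounded_up_tendsto \<epsilon>)
  have "filterlim (\<lambda>n. \<epsilon> * sqrt (real n)) at_top sequentially" using \<epsilon> by real_asymp
  then have "eventually (\<lambda>n. \<epsilon> * sqrt n \<ge> real k + 3) sequentially" by (simp add: filterlim_at_top)
  moreover have "eventually (\<lambda>n. (\<Sum>j=1..n. scaled_tail k \<epsilon> j n) > sqrt pi - \<delta>) sequentially"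
    using L(1) \<epsilon> by (intro order_tendstoD(1)[OF lim]) (simp add: \<epsilon>_def)
  moreover have "eventually (\<lambda>n. (\<Sum>j=1..n. scaled_tail k \<epsilon> j n)
      + real (nat \<lceil>\<epsilon> * sqrt n\<rceil>) / sqrt n < sqrt pi + \<delta>) sequentially"
    using L(2) \<epsilon> by (intro order_tendstoD(2)[OF lim']) (simp add: \<epsilon>_def)
  ultimately have "eventually (\<lambda>n. norm (average_height n k / sqrt n - sqrt pi) < \<delta>) sequentially"
    using eventually_ge_at_top[of 1]
  proof eventually_elim
    case (elim n)
    then show ?case using average_height_bounds[of n k \<epsilon>] by (simp add: abs_less_iff)
  qed
  then show "\<exists>no. \<forall>n\<ge>no. norm (average_height n k / sqrt n - sqrt pi) < \<delta>"
    by (simp add: eventually_sequentially)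
qed

theorem mainTheorem8:
  fixes k :: nat
  shows "(\<lambda>n. average_height n k) \<sim>[at_top] (\<lambda>n. sqrt (pi * real n))"
proof (rule asymp_equivI')
  have "(\<lambda>n. average_height n k / sqrt n / sqrt pi) \<longlonglongrightarrow> sqrt pi / sqrt pi"
    by (intro tendsto_divide average_height_tendsto tendsto_const) simp
  then show "(\<lambda>n. average_height n k / sqrt (pi * real n)) \<longlonglongrightarrow> 1"
    by (simp add: real_sqrt_mult mult.commute)
qed

end
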